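(* Let $A$ be a discriminant form, $k\in\frac12\mathbb{Z}$, $e\in A$ an isotropic element of order $N$, and $t\in\mathbb{Z}_{\geq0}$. Assume $f=\sum_{\lambda\in A}f_\lambda\mathfrak{e}_\lambda\in M_{k,A}$ is supported on $\bigcup_{d\mid N,\ \Omega(d)=t}I_d^\perp$, that is, $f_\lambda=0$ for all $\lambda\in A$ unless $\Omega(\mathrm{cont}_e(\lambda))\geq t$. Then there exist modular forms $f_d\in M_{k,A(d)}$ such that \[f=\sum_{d\mid N,\ \Omega(d)\geq t}f_d\uparrow_{I_d}^A.\]
   Context: A discriminant form is a finite abelian group $A$ with a non-degenerate quadratic form $Q:A\to\mathbb{Q}/\mathbb{Z}$, bilinear form $(x,y)=Q(x+y)-Q(x)-Q(y)$, signature $\mathrm{sig}(A)$ with $\sum_{\lambda}e(Q(\lambda))=\sqrt{|A|}e(\mathrm{sig}(A)/8)$. $\mathrm{Mp}_2(\mathbb{Z})$ is the metaplectic double cover of $\mathrm{SL}_2(\mathbb{Z})$ generated by $T=(\begin{pmatrix}1&1\\0&1\end{pmatrix},1)$, $S=(\begin{pmatrix}0&-1\\1&0\end{pmatrix},\sqrt\tau)$; $\rho_A$ is the Weil representation on $\mathbb{C}[A]$: $\rho_A(T)\mathfrak{e}_\lambda=e(Q(\lambda))\mathfrak{e}_\lambda$, $\rho_A(S)\mathfrak{e}_\lambda=\frac{e(-\mathrm{sig}(A)/8)}{\sqrt{|A|}}\sum_\mu e(-(\lambda,\mu))\mathfrak{e}_\mu$. $M_{k,A}$: holomorphic $f:\mathbb{H}\to\mathbb{C}[A]$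 with $f(M\tau)=\phi(\tau)^{2k}\rho_A(M,\phi)f(\tau)$, holomorphic at $\infty$. For an isotropic subgroup $H$ and $g\in M_{k,H^\perp/H}$, $g\uparrow_H^A=\sum_{\mu\in H^\perp}g_{\mu+H}\mathfrak{e}_\mu\in M_{k,A}$. $\Omega(d)$ is the number of prime factors of $d$ counted with multiplicity. For $e$ isotropic of order $N$: $\mathrm{cont}_e(\lambda)=\gcd(N(e,\lambda),N)$ (with $N(e,\lambda)\in\mathbb{Z}/N\mathbb{Z}$); for $d\mid N$, $I_d=\langle\frac Nde\rangle$, $I_d^\perp=\{\lambda:d\mid\mathrm{cont}_e(\lambda)\}$, and $A(d)=I_d^\perp/I_d$ with the induced quadratic form. *)

theory Defs
  imports
    "HOL-Analysis.Analysis"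
    "HOL-Algebra.Multiplicative_Group"
    "HOL-Algebra.Bij"
begin

unbundle no fps_syntax

section \<open>The group of rationals modulo the integers\<close>

quotient_type rat_mod_int = rat / "\<lambda>x y :: rat. x - y \<in> \<int>"
proof (rule equivpI)
  show "reflp (\<lambda>x y :: rat. x - y \<in> \<int>)"
    by (simp add: reflp_def)
  show "symp (\<lambda>x y :: rat. x - y \<in> \<int>)"
    by (metis (mono_tags, lifting) Ints_minus minus_diff_eq sympI)
  show "transp (\<lambda>x y :: rat. x - y \<in> \<int>)"
  proof (rule transpI)
    fix x y z :: rat
    assume "x - y \<in> \<int>" "y - z \<in> \<int>"
    then have "(x - y) + (y - z) \<in> \<int>" by (rule Ints_add)
    then show "x - z \<in> \<int>" by simp
  qed
qed

instantiation rat_mod_int :: ab_group_add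
begin

lift_definition zero_rat_mod_int :: rat_mod_int is "0 :: rat" .

lift_definition plus_rat_mod_int :: "rat_mod_int \<Rightarrow> rat_mod_int \<Rightarrow> rat_mod_int" is "(+)"
  by (metis Ints_add add_diff_add)

lift_definition uminus_rat_mod_int :: "rat_mod_int \<Rightarrow> rat_mod_int" is "uminus"
  by (metis Ints_minus minus_diff_minus)

lift_definition minus_rat_mod_int :: "rat_mod_int \<Rightarrow> rat_mod_int \<Rightarrow> rat_mod_int" is "(-)"
  by (metis Ints_diff diff_diff_eq2 diff_add_eq add_diff_eq)

instance
  by standard (transfer; simp add: algebra_simps)+

end

lift_definition int_scale :: "int \<Rightarrow> rat_mod_int \<Rightarrow> rat_mod_int" is "\<lambda>n x. of_int n * x"
  by (metis Ints_mult Ints_of_int right_diff_distrib)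

text \<open>The representative in the half-open unit interval.\<close>

lift_definition unit_rep :: "rat_mod_int \<Rightarrow> rat" is "frac"
proof -
  fix x y :: rat
  assume "x - y \<in> \<int>"
  then obtain n where "x - y = of_int n" by (auto elim: Ints_cases)
  then have "x = y + of_int n" by (simp add: algebra_simps)
  then show "frac x = frac y" by (simp add: frac_def)
qed

definition e_fun :: "complex \<Rightarrow> complex" where
  "e_fun z = exp (2 * of_real pi * \<i> * z)"

lift_definition e_class :: "rat_mod_int \<Rightarrow> complex" is "\<lambda>x. e_fun (of_rat x)"
proof -
  fix x y :: rat
  assume "x - y \<in> \<int>"
  then obtain n where n: "x - y = of_int n" by (auto elim: Ints_cases)
  have x: "x = y + of_int n" using n by (simp add: algebra_simps)
  show "e_fun (of_rat x) = e_fun (of_rat y)"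
    unfolding e_fun_def exp_eq
    by (intro exI[of _ n]) (simp add: x of_rat_add algebra_simps)
qed

section \<open>Discriminant forms\<close>

text \<open>The finite abelian group is written multiplicatively, following the conventions of the
  group theory library.\<close>

record 'a disc_form = "'a monoid" +
  quad :: "'a \<Rightarrow> rat_mod_int"

definition bil :: "'a disc_form \<Rightarrow> 'a \<Rightarrow> 'a \<Rightarrow> rat_mod_int" where
  "bil A x y = quad A (x \<otimes>\<^bsub>A\<^esub> y) - quad A x - quad A y"

locale discriminant_form = comm_group A for A :: "'a disc_form" (structure) +
  assumes finite_carrier: "finite (carrier A)"
    and quad_int_pow: "x \<in> carrier A \<Longrightarrow> quad A (x [^] (n :: int)) = int_scale (n\<^sup>2) (quad A x)"
    and bil_mult_left: "\<lbrakk>x \<in> carrier A; y \<in> carrier A; z \<in> carrier A\<rbrakk> \<Longrightarrow>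
           bil A (x \<otimes> y) z = bil A x z + bil A y z"
    and nondegenerate: "\<lbrakk>x \<in> carrier A; \<And>y. y \<in> carrier A \<Longrightarrow> bil A x y = 0\<rbrakk> \<Longrightarrow> x = \<one>"

text \<open>The signature is an integer determined modulo 8; an arbitrary representative is chosen.\<close>

definition signature :: "'a disc_form \<Rightarrow> int" where
  "signature A = (SOME s. (\<Sum>x\<in>carrier A. e_class (quad A x)) =
     of_real (sqrt (card (carrier A))) * e_fun (of_int s / 8))"

definition orth :: "'a disc_form \<Rightarrow> 'a set \<Rightarrow> 'a set" where
  "orth A H = {x \<in> carrier A. \<forall>h\<in>H. bil A h x = 0}"

text \<open>The subquotient of \<open>A\<close> attached to an isotropic subgroup \<open>H\<close>: the orthogonal complement of
  \<open>H\<close> modulo \<open>H\<close>. The quadratic form is constant on the cosets of \<open>H\<close> in it.\<close>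

definition subquotient :: "'a disc_form \<Rightarrow> 'a set \<Rightarrow> 'a set disc_form" where
  "subquotient A H = monoid.extend ((A\<lparr>carrier := orth A H\<rparr>) Mod H)
     (disc_form.fields (\<lambda>C. the_elem (quad A ` C)))"

lemma subquotient_simps:
  "carrier (subquotient A H) = {H #>\<^bsub>A\<^esub> a | a. a \<in> orth A H}"
  "quad (subquotient A H) C = the_elem (quad A ` C)"
  by (auto simp: subquotient_def monoid.defs disc_form.defs FactGroup_def RCOSETS_def r_coset_def)

section \<open>The metaplectic group and the Weil representation\<close>

definition upper_half_plane :: "complex set" where
  "upper_half_plane = {\<tau>. Im \<tau> > 0}"

definition moebius_act :: "int^2^2 \<Rightarrow> complex \<Rightarrow> complex" where
  "moebius_act M \<tau> = (of_int (M$1$1) * \<tau> + of_int (M$1$2)) / (of_int (M$2$1) * \<tau> + of_int (M$2$2))"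

text \<open>Functions on the upper half-plane are made extensional, so that every matrix has
  exactly two lifts.\<close>

definition Mp2Z :: "((int^2^2) \<times> (complex \<Rightarrow> complex)) monoid" where
  "Mp2Z = \<lparr>carrier = {(M, \<phi>). det M = 1 \<and> \<phi> \<in> extensional upper_half_plane \<and>
              \<phi> holomorphic_on upper_half_plane \<and>
              (\<forall>\<tau>\<in>upper_half_plane. (\<phi> \<tau>)\<^sup>2 = of_int (M$2$1) * \<tau> + of_int (M$2$2))},
    mult = (\<lambda>(M1, \<phi>1) (M2, \<phi>2).
      (M1 ** M2, \<lambda>\<tau>\<in>upper_half_plane. \<phi>1 (moebius_act M2 \<tau>) * \<phi>2 \<tau>)),
    one = (mat 1, \<lambda>\<tau>\<in>upper_half_plane. 1)\<rparr>"

definition Mp2_T :: "(int^2^2) \<times> (complex \<Rightarrow> complex)" where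
  "Mp2_T = (vector [vector [1, 1], vector [0, 1]], \<lambda>\<tau>\<in>upper_half_plane. 1)"

definition Mp2_S :: "(int^2^2) \<times> (complex \<Rightarrow> complex)" where
  "Mp2_S = (vector [vector [0, -1], vector [1, 0]], \<lambda>\<tau>\<in>upper_half_plane. csqrt \<tau>)"

text \<open>The space \<open>\<complex>[A]\<close>: functions vanishing outside the carrier, with standard basis
  \<open>basis_vec x\<close>.\<close>

definition group_algebra :: "'a disc_form \<Rightarrow> ('a \<Rightarrow> complex) set" where
  "group_algebra A = {v. \<forall>x. x \<notin> carrier A \<longrightarrow> v x = 0}"

definition basis_vec :: "'a \<Rightarrow> 'a \<Rightarrow> complex" where
  "basis_vec x = (\<lambda>y. if y = x then 1 else 0)"

text \<open>\<open>\<rho>\<close> is a representation of the metaplectic group on \<open>\<complex>[A]\<close> with the prescribed values on the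
  generators; this determines \<open>\<rho>\<close> uniquely on the carrier of \<^const>\<open>Mp2Z\<close>.\<close>

definition is_weil_representation ::
    "'a disc_form \<Rightarrow> ((int^2^2) \<times> (complex \<Rightarrow> complex) \<Rightarrow> ('a \<Rightarrow> complex) \<Rightarrow> ('a \<Rightarrow> complex)) \<Rightarrow> bool" where
  "is_weil_representation A \<rho> \<longleftrightarrow>
     \<rho> \<in> hom Mp2Z (BijGroup (group_algebra A)) \<and>
     (\<forall>g\<in>carrier Mp2Z. \<forall>v\<in>group_algebra A. \<forall>w\<in>group_algebra A. \<forall>a b.
        \<rho> g (\<lambda>x. a * v x + b * w x) = (\<lambda>x. a * \<rho> g v x + b * \<rho> g w x)) \<and>
     (\<forall>l\<in>carrier A. \<rho> Mp2_T (basis_vec l) = (\<lambda>x. e_class (quad A l) * basis_vec l x)) \<and>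
     (\<forall>l\<in>carrier A. \<rho> Mp2_S (basis_vec l) =
        (\<lambda>x. e_fun (- of_int (signature A) / 8) / of_real (sqrt (card (carrier A))) *
             (\<Sum>m\<in>carrier A. e_class (- bil A l m) * basis_vec m x)))"

section \<open>Vector valued modular forms\<close>

text \<open>\<open>h\<close> is, for some \<open>N > 0\<close>, a function of \<open>exp (2 \<pi> \<i> \<tau> / N)\<close> extending holomorphically to 0.\<close>

definition holomorphic_at_cusp :: "(complex \<Rightarrow> complex) \<Rightarrow> bool" where
  "holomorphic_at_cusp h \<longleftrightarrow> (\<exists>N>0. \<exists>F. F holomorphic_on ball 0 1 \<and>
     (\<forall>\<tau>\<in>upper_half_plane. h \<tau> = F (e_fun (\<tau> / of_nat N))))"

text \<open>Only the values on the upper half-plane matter. The weight \<open>k\<close> is meant to be a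
  half-integer, so that the floor of \<open>2 * k\<close> is \<open>2 * k\<close> itself.\<close>

definition modular_forms :: "rat \<Rightarrow> 'a disc_form \<Rightarrow> (complex \<Rightarrow> 'a \<Rightarrow> complex) set" where
  "modular_forms k A = {f.
     (\<forall>\<tau>\<in>upper_half_plane. f \<tau> \<in> group_algebra A) \<and>
     (\<forall>l\<in>carrier A. (\<lambda>\<tau>. f \<tau> l) holomorphic_on upper_half_plane) \<and>
     (\<exists>\<rho>. is_weil_representation A \<rho> \<and>
        (\<forall>(M, \<phi>)\<in>carrier Mp2Z. \<forall>\<tau>\<in>upper_half_plane.
           f (moebius_act M \<tau>) = (\<lambda>x. \<phi> \<tau> powi \<lfloor>2 * k\<rfloor> * \<rho> (M, \<phi>) (f \<tau>) x))) \<and>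
     (\<forall>l\<in>carrier A. holomorphic_at_cusp (\<lambda>\<tau>. f \<tau> l))}"

definition up_arrow :: "'a disc_form \<Rightarrow> 'a set \<Rightarrow> (complex \<Rightarrow> 'a set \<Rightarrow> complex) \<Rightarrow> complex \<Rightarrow> 'a \<Rightarrow> complex" where
  "up_arrow A H g \<tau> = (\<lambda>x. \<Sum>m\<in>orth A H. g \<tau> (H #>\<^bsub>A\<^esub> m) * basis_vec m x)"

section \<open>The subgroups attached to an isotropic element\<close>

definition big_omega :: "nat \<Rightarrow> nat" where
  "big_omega d = size (prime_factorization d)"

text \<open>For \<open>e\<close> of order \<open>N\<close> the value \<open>(e, l)\<close> is killed by \<open>N\<close>, so that \<open>N\<close> times its rational
  representative is an integer, whose residue modulo \<open>N\<close> is \<open>N (e, l)\<close>.\<close>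

definition cont :: "'a disc_form \<Rightarrow> 'a \<Rightarrow> 'a \<Rightarrow> nat" where
  "cont A e l = (let N = group.ord A e in gcd (nat \<lfloor>of_nat N * unit_rep (bil A e l)\<rfloor>) N)"

definition I_sub :: "'a disc_form \<Rightarrow> 'a \<Rightarrow> nat \<Rightarrow> 'a set" where
  "I_sub A e d = generate A {e [^]\<^bsub>A\<^esub> (group.ord A e div d)}"

text \<open>The orthogonal complement of \<open>I_sub A e d\<close> is described by \<^const>\<open>cont\<close>; see \<open>orth_I_sub\<close>.\<close>

lemma int_scale_add: "int_scale (a + b) q = int_scale a q + int_scale b q"
  by transfer (simp add: algebra_simps)
lemma int_scale_0: "int_scale 0 q = 0" by transfer simp
lemma int_scale_zero: "int_scale n 0 = 0" by transfer simp
lemma int_scale_1: "int_scale 1 q = q" by transfer simp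

lemma scale_zero_iff:
  assumes "N > 0" "d dvd N" "int_scale (int N) q = 0"
  shows "int_scale (int (N div d)) q = 0 \<longleftrightarrow> d dvd nat \<lfloor>of_nat N * unit_rep q\<rfloor>"
  using assms
proof (transfer fixing: N d)
  fix q :: rat
  assume N: "N > 0" and d: "d dvd N" and q: "of_int (int N) * q - 0 \<in> \<int>"
  define r where "r = frac q"
  have r0: "r \<ge> 0" by (simp add: r_def)
  have z: "q = r + of_int \<lfloor>q\<rfloor>" by (simp add: r_def frac_def)
  have "of_nat N * r = of_int (int N) * q - of_int (int N * \<lfloor>q\<rfloor>)" by (simp add: r_def frac_def algebra_simps)
  then have "of_nat N * r \<in> \<int>" using q by (simp del: of_int_mult)
  then obtain m0 where m0: "of_nat N * r = of_int m0" by (auto elim: Ints_cases)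
  have "m0 \<ge> 0" using mult_nonneg_nonneg[of "of_nat N" r] r0 m0 by simp
  then obtain m where m: "of_nat N * r = of_nat m" using m0 that[of "nat m0"] by simp
  have fl: "nat \<lfloor>of_nat N * r\<rfloor> = m" by (simp add: m)
  obtain c where c: "N = d * c" using d by auto
  have dp: "d > 0" using N c by auto
  have "of_int (int (N div d)) * q - 0 \<in> \<int> \<longleftrightarrow> of_nat c * r \<in> (\<int> :: rat set)"
  proof -
    have "of_int (int (N div d)) * q - 0 = of_nat c * r + of_int (int c * \<lfloor>q\<rfloor>)"
      using dp by (simp add: r_def frac_def c algebra_simps)
    then show ?thesis by (simp del: of_int_mult)
  qed
  also have "\<dots> \<longleftrightarrow> d dvd m"
  proof
    assume "of_nat c * r \<in> (\<int> :: rat set)"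
    then obtain y where y: "of_nat c * r = of_int y" by (auto elim: Ints_cases)
    have "of_nat m = of_nat d * (of_nat c * r)" using m c by simp
    then have "of_int (int m) = (of_int (int d * y) :: rat)" by (simp add: y)
    then have "int m = int d * y" by (simp only: of_int_eq_iff)
    then show "d dvd m" using int_dvd_int_iff[of d m] by simp
  next
    assume "d dvd m"
    then obtain y where "m = d * y" by auto
    then have "of_nat d * (of_nat c * r) = of_nat d * (of_nat y :: rat)" using m c by simp
    then have "of_nat c * r = (of_nat y :: rat)" using dp by simp
    then show "of_nat c * r \<in> (\<int> :: rat set)" by simp
  qed
  finally show "(of_int (int (N div d)) * q - 0 \<in> \<int>) = (d dvd nat \<lfloor>of_nat N * frac q\<rfloor>)"
    using fl r_def by simp
qed

context discriminant_form begin

lemma bil_pow: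
  assumes "x \<in> carrier A" "l \<in> carrier A"
  shows "bil A (x [^] (n::nat)) l = int_scale (int n) (bil A x l)"
proof (induction n)
  case 0
  have "bil A \<one> l + bil A \<one> l = bil A \<one> l" using bil_mult_left[of \<one> \<one> l] assms by simp
  then show ?case by (simp add: int_scale_0)
next
  case (Suc n)
  then show ?case using assms bil_mult_left[of "x [^] n" x l]
    int_scale_add[of "int n" 1 "bil A x l"] by (simp add: int_scale_1 add.commute)
qed

lemma orth_generate:
  assumes "x \<in> carrier A"
  shows "orth A (generate A {x}) = {l\<in>carrier A. bil A x l = 0}"
proof -
  have "bil A h l = 0" if "h \<in> generate A {x}" "l \<in> carrier A" "bil A x l = 0" for h l
  proof -
    have "h \<in> {x [^] k | k. k \<in> (UNIV::nat set)}" using that(1)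
      generate_pow_on_finite_carrier[OF finite_carrier assms] by simp
    then obtain n :: nat where "h = x [^] n" by auto
    then show ?thesis using bil_pow[OF assms that(2)] that(3) by (simp add: int_scale_zero)
  qed
  then show ?thesis unfolding orth_def using generate.incl[of x "{x}" A] by blast
qed

lemma orth_I_sub:
  assumes e: "e \<in> carrier A" and d: "d dvd ord e"
  shows "orth A (I_sub A e d) = {l \<in> carrier A. d dvd cont A e l}"
proof -
  have N: "ord e > 0" using ord_ge_1[OF finite_carrier e] by simp
  have "bil A (e [^] (ord e div d)) l = 0 \<longleftrightarrow> d dvd cont A e l" if l: "l \<in> carrier A" for l
  proof -
    have "bil A (e [^] ord e) l = 0"
      using bil_pow[OF e l, of 0] e by (simp add: int_scale_0)
    then have "int_scale (int (ord e)) (bil A e l) = 0" using bil_pow[OF e l] by simp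
    from scale_zero_iff[OF N d this] show ?thesis
      using d by (simp add: bil_pow[OF e l] cont_def Let_def)
  qed
  then show ?thesis unfolding I_sub_def using e by (subst orth_generate) auto
qed

end

end

theory Submission
  imports Defs
begin

text \<open>The operators \<open>P\<^sub>d v(x) = [x \<in> I\<^sub>d\<^sup>\<bottom>] (1/d) \<Sum>h\<in>I\<^sub>d. v(h x)\<close>, that is \<open>1/d\<close> times the
  arrow down to \<open>A(d)\<close> followed by the arrow up, commute with the Weil representation, and the
  claim is that \<open>f = \<Sum>\<^sub>d c\<^sub>d P\<^sub>d f\<close>, where \<open>\<Sum>d | d dvd m \<and> \<Omega> d \<ge> t. c\<^sub>d = 1\<close> for all \<open>m\<close> with
  \<open>\<Omega> m \<ge> t\<close> (Moebius inversion).

  Decompose \<open>v = f \<tau>\<close> under translation by \<open>e\<close>: for \<open>N(e,x) = a\<close> the part of \<open>v\<close> at \<open>x\<close> on which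
  translation by \<open>e\<close> acts as \<open>exp(2\<pi>ib/N)\<close> is kept by \<open>P\<^sub>d\<close> if \<open>d\<close> divides \<open>gcd(a,b)\<close> and is killed
  otherwise. The Weil representation permutes the pairs \<open>(a,b)\<close> through \<open>SL\<^sub>2(\<int>)\<close>, and \<open>S T\<^sup>n\<close> takes
  \<open>(a,b)\<close> to one with first entry \<open>b + n a\<close> up to sign. Choosing \<open>n\<close> with
  \<open>gcd(b + n a, N) = gcd(a,b,N)\<close>, the support condition for \<open>f(S T\<^sup>n \<tau>)\<close> shows that only parts with
  \<open>\<Omega>(gcd(a,b,N)) \<ge> t\<close> occur, and on these \<open>\<Sum>\<^sub>d c\<^sub>d P\<^sub>d\<close> is the identity.

  The Weil representation of \<open>A(d)\<close> is obtained from that of \<open>A\<close> by conjugation with the arrows.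
  This needs that \<open>S\<close> and \<open>T\<close> generate the metaplectic group, and that \<open>A\<close> and \<open>A(d)\<close> have the same
  signature modulo 8.\<close>

section \<open>Characters of discriminant forms\<close>

lemma e_fun_add: "e_fun (x + y) = e_fun x * e_fun y"
  by (simp add: e_fun_def exp_add ring_distribs)

lemma e_fun_of_nat_mult: "e_fun (of_nat n * x) = e_fun x ^ n"
  unfolding e_fun_def exp_of_nat_mult[symmetric] by (simp add: algebra_simps)

lemma e_fun_nonzero [simp]: "e_fun x \<noteq> 0"
  by (simp add: e_fun_def)

lemma e_fun_minus: "e_fun (- x) = inverse (e_fun x)"
  by (simp add: e_fun_def exp_minus)

lemma e_class_0 [simp]: "e_class 0 = 1"
  by transfer (simp add: e_fun_def)

lemma e_class_add: "e_class (x + y) = e_class x * e_class y"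
  by transfer (simp add: of_rat_add e_fun_add)

lemma e_class_nonzero [simp]: "e_class x \<noteq> 0"
  by transfer simp

lemma e_class_minus: "e_class (- x) = inverse (e_class x)"
  using e_class_add[of x "- x"] by (simp add: field_simps)

text \<open>The character is faithful on the rationals modulo the integers, so a nonzero value of
  the bilinear form gives a root of unity different from 1. The vanishing of the character sums
  below rests on this.\<close>

lemma e_class_eq_1_iff: "e_class x = 1 \<longleftrightarrow> x = 0"
proof transfer
  fix x :: rat
  have "e_fun (of_rat x) = 1 \<longleftrightarrow> (\<exists>n::int. 2 * complex_of_real pi * \<i> * of_rat x = of_int (2 * n) * of_real pi * \<i>)"
    unfolding e_fun_def using exp_eq[of "2 * complex_of_real pi * \<i> * of_rat x" 0] by simp
  also have "\<dots> \<longleftrightarrow> (\<exists>n::int. complex_of_rat x = of_int n)"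
  proof -
    have "2 * complex_of_real pi * \<i> * of_rat x = of_int (2 * n) * of_real pi * \<i> \<longleftrightarrow>
        (2 * complex_of_real pi * \<i>) * of_rat x = (2 * complex_of_real pi * \<i>) * of_int n" for n
      by (simp add: mult_ac)
    then show ?thesis by (simp only: mult_cancel_left) simp
  qed
  also have "\<dots> \<longleftrightarrow> (\<exists>n::int. x = of_int n)"
    by (metis of_rat_of_int_eq of_rat_eq_iff)
  also have "\<dots> \<longleftrightarrow> x \<in> \<int>"
    by (auto simp: Ints_def)
  finally show "(e_fun (of_rat x) = 1) = (x - 0 \<in> \<int>)" by simp
qed

lemma e_class_int_scale: "e_class (int_scale (int n) x) = e_class x ^ n"
  by transfer (simp add: of_rat_mult e_fun_of_nat_mult)

text \<open>A class killed by \<open>N\<close> has a representative \<open>m / N\<close>, with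
  \<open>m\<close> the integer that enters \<open>cont\<close>. The values \<open>(e, x)\<close>
  thus become powers of one primitive root of unity.\<close>

lemma e_class_root_of_unity:
  assumes "N > 0" "int_scale (int N) q = 0"
  shows "e_class q = e_fun (1 / of_nat N) ^ nat \<lfloor>of_nat N * unit_rep q\<rfloor>"
  using assms
proof (transfer fixing: N)
  fix q :: rat
  assume N: "N > 0" and q: "of_int (int N) * q - 0 \<in> \<int>"
  have "of_nat N * frac q = of_int (int N) * q - of_int (int N * \<lfloor>q\<rfloor>)"
    by (simp add: frac_def algebra_simps)
  then have "of_nat N * frac q \<in> \<int>" using q by (simp del: of_int_mult)
  then obtain m0 where m0: "of_nat N * frac q = of_int m0" by (auto elim: Ints_cases)
  have "m0 \<ge> 0" using mult_nonneg_nonneg[of "of_nat N" "frac q"] m0 by simp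
  then obtain m where m: "of_nat N * frac q = of_nat m" using m0 that[of "nat m0"] by simp
  have qm: "q = of_nat m / of_nat N + of_int \<lfloor>q\<rfloor>"
    using m N by (simp add: frac_def field_simps)
  have "e_fun (of_rat q) = e_fun (of_nat m / of_nat N) * e_fun (of_int \<lfloor>q\<rfloor>)"
    by (subst qm) (simp add: of_rat_add of_rat_divide e_fun_add)
  also have "e_fun (of_int \<lfloor>q\<rfloor>) = 1"
    unfolding e_fun_def exp_eq_1 by (auto intro!: exI[of _ "\<lfloor>q\<rfloor>"])
  also have "e_fun (of_nat m / of_nat N) = e_fun (1 / of_nat N) ^ m"
    using e_fun_of_nat_mult[of m "1 / of_nat N"] by simp
  finally show "e_fun (of_rat q) = e_fun (1 / of_nat N) ^ nat \<lfloor>of_nat N * frac q\<rfloor>"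
    by (simp add: m)
qed

lemma e_fun_power_eq_1_iff:
  assumes "N > 0"
  shows "e_fun (1 / of_nat N) ^ m = 1 \<longleftrightarrow> N dvd m"
proof -
  have "e_fun (1 / of_nat N) ^ m = exp (2 * of_real pi * \<i> * of_nat m / of_nat N)"
    using e_fun_of_nat_mult[of m "1 / of_nat N"] by (simp add: e_fun_def)
  then show ?thesis
    using complex_root_unity_eq_1[of N m] assms by (simp add: mult_ac)
qed

text \<open>A root of unity determines its exponent only modulo \<open>N\<close>, but this fixes the
  gcd with \<open>N\<close>; the content can therefore be read off from a character value.\<close>

lemma gcd_eq_if_e_fun_power_eq:
  assumes "N > 0" "e_fun (1 / of_nat N) ^ m = e_fun (1 / of_nat N) ^ n"
  shows "gcd m N = gcd n N"
proof -
  have *: "gcd m N = gcd n N" if "m \<le> n" "e_fun (1 / of_nat N) ^ m = e_fun (1 / of_nat N) ^ n" for m n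
  proof -
    have "e_fun (1 / of_nat N) ^ (n - m) = 1"
      using that by (simp add: power_diff)
    then have "N dvd n - m" using e_fun_power_eq_1_iff[OF assms(1)] by simp
    then obtain k where "n - m = N * k" ..
    then have "n = m + N * k" using that(1) by simp
    then show ?thesis using gcd_add_mult[of N k m] by (simp add: ac_simps)
  qed
  show ?thesis
    using *[of m n] *[of n m] assms(2) nat_le_linear by metis
qed

lemma sum_powers_root_of_unity:
  fixes z :: complex
  assumes "z ^ n = 1"
  shows "(\<Sum>j<n. z ^ j) = (if z = 1 then of_nat n else 0)"
  using assms by (simp add: geometric_sum)

context discriminant_form
begin

lemma bil_sym: "\<lbrakk>x \<in> carrier A; y \<in> carrier A\<rbrakk> \<Longrightarrow> bil A x y = bil A y x"
  by (simp add: bil_def m_comm)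

lemma bil_mult_right:
  "\<lbrakk>x \<in> carrier A; y \<in> carrier A; z \<in> carrier A\<rbrakk> \<Longrightarrow> bil A x (y \<otimes> z) = bil A x y + bil A x z"
  using bil_mult_left[of y z x] by (simp add: bil_sym[of x])

lemma bil_one_left [simp]: "y \<in> carrier A \<Longrightarrow> bil A \<one> y = 0"
  using bil_mult_left[of \<one> \<one> y] by simp

lemma bil_one_right [simp]: "y \<in> carrier A \<Longrightarrow> bil A y \<one> = 0"
  using bil_sym[of y \<one>] by simp

lemma bil_inv_left: "\<lbrakk>x \<in> carrier A; y \<in> carrier A\<rbrakk> \<Longrightarrow> bil A (inv x) y = - bil A x y"
  using bil_mult_left[of "inv x" x y] by (simp add: eq_neg_iff_add_eq_0)

lemma quad_one [simp]: "quad A \<one> = 0"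
  using quad_int_pow[of \<one> 0] by (simp add: int_scale_0)

lemma quad_mult: "quad A (x \<otimes> y) = quad A x + quad A y + bil A x y"
  by (simp add: bil_def)

lemma quad_mult_isotropic:
  "\<lbrakk>quad A h = 0; bil A h x = 0\<rbrakk> \<Longrightarrow> quad A (h \<otimes> x) = quad A x"
  by (simp add: quad_mult)

text \<open>Orthogonality of characters: if some \<open>g\<close> in \<open>H\<close> pairs
  nontrivially with \<open>x\<close>, translating the summation by \<open>g\<close> multiplies the
  sum by a number other than 1, so the sum is 0.\<close>

lemma sum_character:
  assumes "subgroup H A" "x \<in> carrier A"
  shows "(\<Sum>h\<in>H. e_class (bil A h x)) = (if x \<in> orth A H then of_nat (card H) else 0)"
proof (cases "x \<in> orth A H")
  case True
  then have "e_class (bil A h x) = 1" if "h \<in> H" for h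
    using that by (simp add: orth_def)
  then show ?thesis using True by simp
next
  case False
  then obtain g where g: "g \<in> H" "bil A g x \<noteq> 0"
    using assms by (auto simp: orth_def)
  have HA: "\<And>h. h \<in> H \<Longrightarrow> h \<in> carrier A" using subgroup.mem_carrier[OF assms(1)] .
  have "(\<Sum>h\<in>H. e_class (bil A h x)) = (\<Sum>h\<in>H. e_class (bil A (g \<otimes> h) x))"
    by (rule sum.reindex_bij_witness[of _ "\<lambda>h. g \<otimes> h" "\<lambda>h. inv g \<otimes> h"])
       (use g HA assms(1) in \<open>auto simp: subgroup.m_closed subgroup.m_inv_closed m_assoc[symmetric]\<close>)
  also have "\<dots> = e_class (bil A g x) * (\<Sum>h\<in>H. e_class (bil A h x))"
    by (simp add: sum_distrib_left bil_mult_left g HA assms(2) e_class_add)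
  finally show ?thesis
    using g(2) False e_class_eq_1_iff[of "bil A g x"] by simp
qed

lemma orth_carrier: "orth A (carrier A) = {\<one>}"
  unfolding orth_def using nondegenerate bil_sym by auto

lemma sum_character_carrier:
  assumes "x \<in> carrier A"
  shows "(\<Sum>y\<in>carrier A. e_class (bil A x y)) = (if x = \<one> then of_nat (card (carrier A)) else 0)"
proof -
  have "(\<Sum>y\<in>carrier A. e_class (bil A x y)) = (\<Sum>y\<in>carrier A. e_class (bil A y x))"
    using assms by (intro sum.cong) (simp_all add: bil_sym)
  then show ?thesis
    using sum_character[OF subgroup_self assms] by (simp add: orth_carrier)
qed

text \<open>Double counting of one double character sum: summing over \<open>H\<close> first leaves
  the orthogonal complement of \<open>H\<close>, summing over \<open>A\<close> first leaves only the
  neutral element by nondegeneracy.\<close>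

lemma card_orth:
  assumes "subgroup H A"
  shows "card H * card (orth A H) = card (carrier A)"
proof -
  have HA: "H \<subseteq> carrier A" using subgroup.subset[OF assms] .
  have 1: "(\<Sum>x\<in>carrier A. \<Sum>h\<in>H. e_class (bil A h x)) = of_nat (card H * card (orth A H))"
  proof -
    have "(\<Sum>x\<in>carrier A. \<Sum>h\<in>H. e_class (bil A h x))
      = (\<Sum>x\<in>carrier A. if x \<in> orth A H then of_nat (card H) else 0)"
      by (simp add: sum_character[OF assms])
    also have "\<dots> = (\<Sum>x\<in>orth A H. of_nat (card H))"
      by (rule sum.mono_neutral_cong_right) (auto simp: finite_carrier orth_def)
    finally show ?thesis by simp
  qed
  have "(\<Sum>x\<in>carrier A. \<Sum>h\<in>H. e_class (bil A h x)) = (\<Sum>h\<in>H. \<Sum>x\<in>carrier A. e_class (bil A h x))"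
    by (rule sum.swap)
  also have "\<dots> = (\<Sum>h\<in>H. if h = \<one> then of_nat (card (carrier A)) else 0)"
    using HA by (intro sum.cong) (auto simp: sum_character_carrier)
  also have "\<dots> = of_nat (card (carrier A))"
    using subgroup.one_closed[OF assms] finite_subset[OF HA finite_carrier] by simp
  finally show ?thesis using 1 by (metis of_nat_eq_iff)
qed

end

section \<open>Generators of the metaplectic group\<close>

lemma mat2_eq_iff: "(M :: 'a^2^2) = M' \<longleftrightarrow>
    M$1$1 = M'$1$1 \<and> M$1$2 = M'$1$2 \<and> M$2$1 = M'$2$1 \<and> M$2$2 = M'$2$2"
  by (auto simp: vec_eq_iff forall_2)

lemma mat2_mult_entries:
  fixes M M' :: "int^2^2"
  shows "(M ** M')$i$j = M$i$1 * M'$1$j + M$i$2 * M'$2$j"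
  by (simp add: matrix_matrix_mult_def sum_2)

lemma moebius_denom_nonzero:
  fixes M :: "int^2^2"
  assumes "det M = 1" "\<tau> \<in> upper_half_plane"
  shows "of_int (M$2$1) * \<tau> + of_int (M$2$2) \<noteq> 0"
proof
  assume *: "of_int (M$2$1) * \<tau> + of_int (M$2$2) = 0"
  then have "Im (of_int (M$2$1) * \<tau> + of_int (M$2$2)) = 0" by simp
  then have c: "M$2$1 = 0" using assms(2) by (simp add: upper_half_plane_def)
  with * have "M$2$2 = 0" by simp
  with c assms(1) show False by (simp add: det_2)
qed

lemma Im_moebius:
  fixes M :: "int^2^2"
  assumes "det M = 1" "\<tau> \<in> upper_half_plane"
  shows "Im (moebius_act M \<tau>) = Im \<tau> / (cmod (of_int (M$2$1) * \<tau> + of_int (M$2$2)))\<^sup>2"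
proof -
  define a b c d where "a = real_of_int (M$1$1)" "b = real_of_int (M$1$2)" "c = real_of_int (M$2$1)" "d = real_of_int (M$2$2)"
  have "real_of_int (M$1$1 * M$2$2 - M$1$2 * M$2$1) = 1" using assms(1) by (simp add: det_2)
  then have D: "a * d - b * c = 1" by (simp add: a_b_c_d_def)
  have m: "moebius_act M \<tau> = (a * \<tau> + b) / (c * \<tau> + d)"
    by (simp add: moebius_act_def a_b_c_d_def)
  have "Im ((a * \<tau> + b) / (c * \<tau> + d)) = (a * d - b * c) * Im \<tau> / (cmod (c * \<tau> + d))\<^sup>2"
    by (simp add: Im_divide cmod_power2 algebra_simps)
  then show ?thesis using m D by (simp add: a_b_c_d_def)
qed

lemma moebius_act_closed:
  assumes "det M = 1" "\<tau> \<in> upper_half_plane"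
  shows "moebius_act M \<tau> \<in> upper_half_plane"
proof -
  have "Im \<tau> > 0" using assms(2) by (simp add: upper_half_plane_def)
  then have "Im (moebius_act M \<tau>) > 0"
    unfolding Im_moebius[OF assms] using moebius_denom_nonzero[OF assms]
    by (intro divide_pos_pos) auto
  then show ?thesis by (simp add: upper_half_plane_def)
qed

lemma moebius_act_mult:
  assumes "det M' = 1" "\<tau> \<in> upper_half_plane"
  shows "moebius_act (M ** M') \<tau> = moebius_act M (moebius_act M' \<tau>)"
proof -
  define q where "q = of_int (M'$2$1) * \<tau> + of_int (M'$2$2)"
  define p where "p = of_int (M'$1$1) * \<tau> + of_int (M'$1$2)"
  have q: "q \<noteq> 0" using moebius_denom_nonzero[OF assms] by (simp add: q_def)
  have m: "moebius_act M' \<tau> = p / q" by (simp add: moebius_act_def p_def q_def)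
  have "moebius_act M (p / q) =
    ((of_int (M$1$1) * p + of_int (M$1$2) * q) / q) / ((of_int (M$2$1) * p + of_int (M$2$2) * q) / q)"
    using q by (simp add: moebius_act_def add_divide_distrib)
  also have "\<dots> = (of_int (M$1$1) * p + of_int (M$1$2) * q) / (of_int (M$2$1) * p + of_int (M$2$2) * q)"
    using q by simp
  also have "\<dots> = moebius_act (M ** M') \<tau>"
    unfolding moebius_act_def mat2_mult_entries p_def q_def by (simp add: algebra_simps)
  finally show ?thesis using m by simp
qed

lemma moebius_act_holomorphic:
  assumes "det M = 1"
  shows "moebius_act M holomorphic_on upper_half_plane"
  unfolding moebius_act_def by (intro holomorphic_intros) (use moebius_denom_nonzero[OF assms] in auto)

lemma Mp2Z_mem:
  "(M, \<phi>) \<in> carrier Mp2Z \<longleftrightarrow> det M = 1 \<and> \<phi> \<in> extensional upper_half_plane \<and>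
     \<phi> holomorphic_on upper_half_plane \<and>
     (\<forall>\<tau>\<in>upper_half_plane. (\<phi> \<tau>)\<^sup>2 = of_int (M$2$1) * \<tau> + of_int (M$2$2))"
  by (simp add: Mp2Z_def)

lemma Mp2Z_mult:
  "(M, \<phi>) \<otimes>\<^bsub>Mp2Z\<^esub> (M', \<phi>') =
     (M ** M', \<lambda>\<tau>\<in>upper_half_plane. \<phi> (moebius_act M' \<tau>) * \<phi>' \<tau>)"
  by (simp add: Mp2Z_def)

lemma Mp2Z_one: "\<one>\<^bsub>Mp2Z\<^esub> = (mat 1, \<lambda>\<tau>\<in>upper_half_plane. 1)"
  by (simp add: Mp2Z_def)

lemma Mp2Z_factor_nonzero:
  assumes "(M, \<phi>) \<in> carrier Mp2Z" "\<tau> \<in> upper_half_plane"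
  shows "\<phi> \<tau> \<noteq> 0"
  using assms moebius_denom_nonzero[of M \<tau>] unfolding Mp2Z_mem by force

text \<open>The denominator of a Moebius transformation is a cocycle: the denominator of
  \<open>M\<close> at the image point, times that of \<open>M'\<close>, is the denominator of
  \<open>M ** M'\<close>. This gives the required square.\<close>

lemma Mp2Z_mult_closed:
  assumes "g \<in> carrier Mp2Z" "h \<in> carrier Mp2Z"
  shows "g \<otimes>\<^bsub>Mp2Z\<^esub> h \<in> carrier Mp2Z"
proof -
  obtain M \<phi> M' \<phi>' where gh: "g = (M, \<phi>)" "h = (M', \<phi>')" by (cases g, cases h)
  have g: "det M = 1" "\<phi> holomorphic_on upper_half_plane"
      "\<And>\<tau>. \<tau> \<in> upper_half_plane \<Longrightarrow> (\<phi> \<tau>)\<^sup>2 = of_int (M$2$1) * \<tau> + of_int (M$2$2)"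
    and h: "det M' = 1" "\<phi>' holomorphic_on upper_half_plane"
      "\<And>\<tau>. \<tau> \<in> upper_half_plane \<Longrightarrow> (\<phi>' \<tau>)\<^sup>2 = of_int (M'$2$1) * \<tau> + of_int (M'$2$2)"
    using assms unfolding gh Mp2Z_mem by blast+
  have "(\<lambda>\<tau>. \<phi> (moebius_act M' \<tau>) * \<phi>' \<tau>) holomorphic_on upper_half_plane"
    using holomorphic_on_compose_gen[OF moebius_act_holomorphic[OF h(1)] g(2)] moebius_act_closed[OF h(1)]
    by (intro holomorphic_on_mult h(2)) (auto simp: o_def)
  then have 1: "(\<lambda>\<tau>\<in>upper_half_plane. \<phi> (moebius_act M' \<tau>) * \<phi>' \<tau>) holomorphic_on upper_half_plane"
    by (rule holomorphic_transform) simp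
  have 2: "(\<phi> (moebius_act M' \<tau>) * \<phi>' \<tau>)\<^sup>2 = of_int ((M ** M')$2$1) * \<tau> + of_int ((M ** M')$2$2)"
    if t: "\<tau> \<in> upper_half_plane" for \<tau>
  proof -
    define q where "q = of_int (M'$2$1) * \<tau> + of_int (M'$2$2)"
    have q: "q \<noteq> 0" using moebius_denom_nonzero[OF h(1) t] by (simp add: q_def)
    have "(\<phi> (moebius_act M' \<tau>) * \<phi>' \<tau>)\<^sup>2 = (of_int (M$2$1) * moebius_act M' \<tau> + of_int (M$2$2)) * q"
      using g(3)[OF moebius_act_closed[OF h(1) t]] h(3)[OF t] by (simp add: power_mult_distrib q_def)
    also have "\<dots> = of_int (M$2$1) * (of_int (M'$1$1) * \<tau> + of_int (M'$1$2)) + of_int (M$2$2) * q"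
      using q unfolding moebius_act_def q_def[symmetric] by (simp add: distrib_right)
    also have "\<dots> = of_int ((M ** M')$2$1) * \<tau> + of_int ((M ** M')$2$2)"
      by (simp add: mat2_mult_entries q_def algebra_simps)
    finally show ?thesis .
  qed
  show ?thesis
    unfolding gh Mp2Z_mult Mp2Z_mem using 1 2 g(1) h(1) by (simp add: det_mul)
qed

lemma Mp2Z_mult_assoc:
  assumes "g \<in> carrier Mp2Z" "h \<in> carrier Mp2Z" "k \<in> carrier Mp2Z"
  shows "(g \<otimes>\<^bsub>Mp2Z\<^esub> h) \<otimes>\<^bsub>Mp2Z\<^esub> k = g \<otimes>\<^bsub>Mp2Z\<^esub> (h \<otimes>\<^bsub>Mp2Z\<^esub> k)"
proof -
  obtain M \<phi> M' \<phi>' M'' \<phi>'' where gh: "g = (M, \<phi>)" "h = (M', \<phi>')" "k = (M'', \<phi>'')"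
    by (cases g, cases h, cases k)
  have "det M' = 1" "det M'' = 1" using assms by (auto simp: gh Mp2Z_mem)
  then show ?thesis unfolding gh Mp2Z_mult
    by (auto simp: matrix_mul_assoc moebius_act_closed moebius_act_mult intro!: restrict_ext)
qed

lemma Mp2Z_one_closed: "\<one>\<^bsub>Mp2Z\<^esub> \<in> carrier Mp2Z"
  unfolding Mp2Z_one Mp2Z_mem
  by (auto simp: det_2 mat_def intro: holomorphic_transform[OF holomorphic_on_const[of 1]])

lemma Mp2_S_closed: "Mp2_S \<in> carrier Mp2Z"
  unfolding Mp2_S_def Mp2Z_mem
proof (intro conjI ballI)
  have "csqrt holomorphic_on upper_half_plane"
    by (intro holomorphic_on_csqrt holomorphic_on_subset[OF holomorphic_on_csqrt])
       (auto simp: upper_half_plane_def complex_nonpos_Reals_iff)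
  then show "(\<lambda>\<tau>\<in>upper_half_plane. csqrt \<tau>) holomorphic_on upper_half_plane"
    by (rule holomorphic_transform) simp
qed (auto simp: det_2)

text \<open>Given as an explicit matrix, so that negative exponents are available without inverses
  in \<open>Mp2Z\<close>.\<close>

definition Mp2_T_pow :: "int \<Rightarrow> (int^2^2) \<times> (complex \<Rightarrow> complex)" where
  "Mp2_T_pow n = (vector [vector [1, n], vector [0, 1]], \<lambda>\<tau>\<in>upper_half_plane. 1)"

lemma Mp2_T_pow_closed: "Mp2_T_pow n \<in> carrier Mp2Z"
  unfolding Mp2_T_pow_def Mp2Z_mem
  by (auto simp: det_2 intro: holomorphic_transform[OF holomorphic_on_const[of 1]])

lemma Mp2_T_eq: "Mp2_T = Mp2_T_pow 1"
  by (simp add: Mp2_T_def Mp2_T_pow_def)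

lemma Mp2_T_closed: "Mp2_T \<in> carrier Mp2Z"
  by (simp add: Mp2_T_eq Mp2_T_pow_closed)

lemma Mp2_T_pow_add: "Mp2_T_pow m \<otimes>\<^bsub>Mp2Z\<^esub> Mp2_T_pow n = Mp2_T_pow (m + n)"
proof -
  have "det (vector [vector [1, n], vector [0, 1]] :: int^2^2) = 1" by (simp add: det_2)
  note cl = moebius_act_closed[OF this]
  show ?thesis
    unfolding Mp2_T_pow_def Mp2Z_mult
    by (auto simp: mat2_eq_iff mat2_mult_entries cl intro!: restrict_ext)
qed

lemma Mp2_T_pow_0: "Mp2_T_pow 0 = \<one>\<^bsub>Mp2Z\<^esub>"
  by (simp add: Mp2_T_pow_def Mp2Z_one mat2_eq_iff mat_def)

lemma Mp2Z_mult_one: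
  assumes "g \<in> carrier Mp2Z"
  shows "g \<otimes>\<^bsub>Mp2Z\<^esub> \<one>\<^bsub>Mp2Z\<^esub> = g"
proof -
  obtain M \<phi> where g: "g = (M, \<phi>)" by (cases g)
  have "\<phi> \<in> extensional upper_half_plane" using assms by (simp add: g Mp2Z_mem)
  moreover have "moebius_act (mat 1) \<tau> = \<tau>" for \<tau> by (simp add: moebius_act_def mat_def)
  ultimately show ?thesis
    unfolding g Mp2Z_one Mp2Z_mult
    by (auto simp: restrict_def extensional_def fun_eq_iff)
qed

text \<open>A continuous function with finite range on a connected set is constant. Hence the
  identity matrix has exactly two lifts.\<close>

lemma square_const_on_upper_half_plane:
  assumes "\<phi> holomorphic_on upper_half_plane" "\<And>\<tau>. \<tau> \<in> upper_half_plane \<Longrightarrow> (\<phi> \<tau>)\<^sup>2 = (1 :: complex)"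
  shows "(\<forall>\<tau>\<in>upper_half_plane. \<phi> \<tau> = 1) \<or> (\<forall>\<tau>\<in>upper_half_plane. \<phi> \<tau> = -1)"
proof -
  have "\<phi> ` upper_half_plane \<subseteq> {1, -1}" using assms(2) power2_eq_1_iff by blast
  then have fin: "finite (\<phi> ` upper_half_plane)" by (rule finite_subset) simp
  have "convex upper_half_plane"
    unfolding upper_half_plane_def by (rule convex_halfspace_Im_gt)
  then have "\<phi> constant_on upper_half_plane"
    by (intro continuous_finite_range_constant convex_connected fin holomorphic_on_imp_continuous_on assms(1))
  then obtain y where y: "\<And>\<tau>. \<tau> \<in> upper_half_plane \<Longrightarrow> \<phi> \<tau> = y" by (auto simp: constant_on_def)
  have "\<i> \<in> upper_half_plane" by (simp add: upper_half_plane_def)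
  then have "y\<^sup>2 = 1" using y assms(2) by metis
  then show ?thesis using y by (metis power2_eq_1_iff)
qed

text \<open>Euclidean descent on the lower left entry by right multiplication with powers of
  \<open>T\<close> and with \<open>S\<close>. The hypotheses on \<open>T\<close> and
  \<open>S\<close> are equivalences, so steps can also be undone and no induction over inverses of
  generators is necessary.\<close>

lemma Mp2Z_generators:
  assumes "g \<in> carrier Mp2Z"
    and one: "P \<one>\<^bsub>Mp2Z\<^esub>"
    and T: "\<And>g. g \<in> carrier Mp2Z \<Longrightarrow> P (g \<otimes>\<^bsub>Mp2Z\<^esub> Mp2_T) \<longleftrightarrow> P g"
    and S: "\<And>g. g \<in> carrier Mp2Z \<Longrightarrow> P (g \<otimes>\<^bsub>Mp2Z\<^esub> Mp2_S) \<longleftrightarrow> P g"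
  shows "P g"
proof -
  have Tpow: "P (g \<otimes>\<^bsub>Mp2Z\<^esub> Mp2_T_pow n) \<longleftrightarrow> P g" if g: "g \<in> carrier Mp2Z" for g n
  proof -
    have step: "P (g \<otimes>\<^bsub>Mp2Z\<^esub> Mp2_T_pow (i + 1)) \<longleftrightarrow> P (g \<otimes>\<^bsub>Mp2Z\<^esub> Mp2_T_pow i)" for i
      using T[OF Mp2Z_mult_closed[OF g Mp2_T_pow_closed], of i]
      by (simp add: Mp2Z_mult_assoc g Mp2_T_pow_closed Mp2_T_eq Mp2_T_pow_add)
    show ?thesis
    proof (induction n rule: int_induct[of _ 0])
      case base
      then show ?case using g by (simp add: Mp2_T_pow_0 Mp2Z_mult_one)
    next
      case (step1 i)
      then show ?case using step by simp
    next
      case (step2 i)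
      then show ?case using step[of "i - 1"] by simp
    qed
  qed
  have S2: "P (g \<otimes>\<^bsub>Mp2Z\<^esub> Mp2_S \<otimes>\<^bsub>Mp2Z\<^esub> Mp2_S) \<longleftrightarrow> P g" if "g \<in> carrier Mp2Z" for g
    using S Mp2Z_mult_closed Mp2_S_closed that by simp
  \<comment> \<open>Descent ends at the identity matrix, where the sign of the lift still has to be
    dealt with.\<close>
  have id: "P (mat 1, \<phi>)" if g: "(mat 1, \<phi>) \<in> carrier Mp2Z" for \<phi>
  proof -
    have ext: "\<phi> \<in> extensional upper_half_plane" using g by (simp add: Mp2Z_mem)
    have "(\<forall>\<tau>\<in>upper_half_plane. \<phi> \<tau> = 1) \<or> (\<forall>\<tau>\<in>upper_half_plane. \<phi> \<tau> = -1)"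
      by (rule square_const_on_upper_half_plane) (use g in \<open>auto simp: Mp2Z_mem mat_def\<close>)
    then show ?thesis
    proof
      assume "\<forall>\<tau>\<in>upper_half_plane. \<phi> \<tau> = 1"
      then have "\<phi> = (\<lambda>\<tau>\<in>upper_half_plane. 1)" using ext by (auto simp: extensional_def fun_eq_iff)
      then show ?thesis using one by (simp add: Mp2Z_one)
    next
      assume m1: "\<forall>\<tau>\<in>upper_half_plane. \<phi> \<tau> = -1"
      \<comment> \<open>\<open>R\<close> lies over minus the identity matrix, with a factor squaring
        to -1. So the square of \<open>R\<close> is the nontrivial lift of the identity, and
        multiplying by it changes the sign of \<open>\<phi>\<close>.\<close>
      define R where "R = Mp2_S \<otimes>\<^bsub>Mp2Z\<^esub> Mp2_S"
      obtain M \<psi> where R: "R = (M, \<psi>)" by (cases R)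
      have Rc: "R \<in> carrier Mp2Z" by (simp add: R_def Mp2Z_mult_closed Mp2_S_closed)
      have M: "M$1$1 = -1" "M$1$2 = 0" "M$2$1 = 0" "M$2$2 = -1"
        using R by (auto simp: R_def Mp2_S_def Mp2Z_mult mat2_mult_entries)
      have \<psi>: "(\<psi> \<tau>)\<^sup>2 = -1" if "\<tau> \<in> upper_half_plane" for \<tau>
        using Rc that by (simp add: R Mp2Z_mem M)
      have act: "moebius_act M \<tau> = \<tau>" for \<tau> by (simp add: moebius_act_def M)
      have detM: "det M = 1" by (simp add: det_2 M)
      have MM: "M ** M = mat 1" by (simp add: mat2_eq_iff mat2_mult_entries M mat_def)
      have "(mat 1, \<phi>) \<otimes>\<^bsub>Mp2Z\<^esub> R \<otimes>\<^bsub>Mp2Z\<^esub> R = \<one>\<^bsub>Mp2Z\<^esub>"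
        unfolding R Mp2Z_mult Mp2Z_one
        using m1 \<psi> by (auto simp: act MM power2_eq_square intro!: restrict_ext)
      moreover have "P ((mat 1, \<phi>) \<otimes>\<^bsub>Mp2Z\<^esub> R \<otimes>\<^bsub>Mp2Z\<^esub> R) \<longleftrightarrow> P (mat 1, \<phi>)"
        using S2[OF g] S2[OF Mp2Z_mult_closed[OF g Rc]] g Rc
        by (simp add: R_def Mp2Z_mult_assoc Mp2_S_closed Mp2Z_mult_closed)
      ultimately show ?thesis using one by simp
    qed
  qed
  have c0d1: "P (M, \<phi>)" if g: "(M, \<phi>) \<in> carrier Mp2Z" and M: "M$2$1 = 0" "M$2$2 = 1" for M \<phi>
  proof -
    have M11: "M$1$1 = 1" using g M by (simp add: Mp2Z_mem det_2)
    obtain M' \<phi>' where g': "(M, \<phi>) \<otimes>\<^bsub>Mp2Z\<^esub> Mp2_T_pow (- M$1$2) = (M', \<phi>')" by fastforce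
    then have "M' = mat 1"
      using M M11 by (auto simp: Mp2_T_pow_def Mp2Z_mult mat2_eq_iff mat2_mult_entries mat_def)
    then show ?thesis
      using id[of \<phi>'] g' Tpow[OF g] Mp2Z_mult_closed[OF g Mp2_T_pow_closed] by metis
  qed
  have c0: "P (M, \<phi>)" if g: "(M, \<phi>) \<in> carrier Mp2Z" and M: "M$2$1 = 0" for M \<phi>
  proof -
    have "M$1$1 * M$2$2 = 1" using g M by (simp add: Mp2Z_mem det_2)
    then consider "M$2$2 = 1" | "M$2$2 = -1" using zmult_eq_1_iff by metis
    then show ?thesis
    proof cases
      case 1
      then show ?thesis using c0d1 g M by simp
    next
      case 2
      \<comment> \<open>The matrix of the square of \<open>S\<close> is minus the identity, which
        turns the entry -1 into 1.\<close>
      obtain M' \<phi>' where g': "(M, \<phi>) \<otimes>\<^bsub>Mp2Z\<^esub> Mp2_S \<otimes>\<^bsub>Mp2Z\<^esub> Mp2_S = (M', \<phi>')" by fastforce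
      then have "M'$2$1 = 0" "M'$2$2 = 1"
        using M 2 by (auto simp: Mp2_S_def Mp2Z_mult mat2_mult_entries)
      then show ?thesis
        using c0d1[of M' \<phi>'] g' S2[OF g] Mp2Z_mult_closed g Mp2_S_closed by metis
    qed
  qed
  have "P (M, \<phi>)" if "(M, \<phi>) \<in> carrier Mp2Z" for M \<phi>
    using that
  proof (induction "nat \<bar>M$2$1\<bar>" arbitrary: M \<phi> rule: less_induct)
    case less
    show ?case
    proof (cases "M$2$1 = 0")
      case True
      then show ?thesis using c0 less.prems by simp
    next
      case False
      \<comment> \<open>With this exponent the new lower left entry is the remainder of
        \<open>M$2$2\<close> modulo \<open>M$2$1\<close>.\<close>
      let ?n = "- (M$2$2 div M$2$1)"
      obtain M' \<phi>' where g': "(M, \<phi>) \<otimes>\<^bsub>Mp2Z\<^esub> Mp2_T_pow ?n \<otimes>\<^bsub>Mp2Z\<^esub> Mp2_S = (M', \<phi>')" by fastforce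
      then have "M'$2$1 = M$2$1 * ?n + M$2$2"
        by (auto simp: Mp2_S_def Mp2_T_pow_def Mp2Z_mult mat2_mult_entries)
      also have "\<dots> = M$2$2 mod M$2$1" by (simp add: minus_mult_div_eq_mod[symmetric])
      finally have "nat \<bar>M'$2$1\<bar> < nat \<bar>M$2$1\<bar>" using False abs_mod_less[of "M$2$1" "M$2$2"] by simp
      moreover have "(M', \<phi>') \<in> carrier Mp2Z"
        using g' Mp2Z_mult_closed less.prems Mp2_S_closed Mp2_T_pow_closed by metis
      ultimately have "P (M', \<phi>')" using less.hyps by blast
      then show ?thesis
        using g' S Tpow less.prems Mp2Z_mult_closed Mp2_T_pow_closed by metis
    qed
  qed
  then show ?thesis using assms(1) by (cases g) auto
qed

text \<open>The product of real and imaginary part of the root is half of \<open>Im z\<close>, hence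
  positive, and the principal branch has nonnegative real part.\<close>

lemma csqrt_quadrant:
  assumes "Im z > 0"
  shows "Re (csqrt z) > 0" "Im (csqrt z) > 0"
proof -
  have "2 * Re (csqrt z) * Im (csqrt z) = Im ((csqrt z)\<^sup>2)" by (simp only: power2_eq_square times_complex.sel) simp
  then have *: "Re (csqrt z) * Im (csqrt z) > 0" using assms by simp
  moreover have "Re (csqrt z) \<ge> 0" using csqrt_principal[of z] by auto
  ultimately show "Re (csqrt z) > 0" "Im (csqrt z) > 0" by (auto simp: zero_less_mult_iff)
qed

text \<open>The matrix identity is a computation; the point is the sign of the square root. Both
  candidates have the same square, and a product of two numbers in the open first quadrant has
  positive imaginary part, so it cannot be \<open>- csqrt \<tau>\<close>.\<close>

lemma Mp2Z_braid:
  "Mp2_T \<otimes>\<^bsub>Mp2Z\<^esub> (Mp2_S \<otimes>\<^bsub>Mp2Z\<^esub> (Mp2_T \<otimes>\<^bsub>Mp2Z\<^esub> (Mp2_S \<otimes>\<^bsub>Mp2Z\<^esub> Mp2_T))) = Mp2_S"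
proof -
  have id: "csqrt (\<tau> / (\<tau> + 1)) * csqrt (\<tau> + 1) = csqrt \<tau>" if t: "Im \<tau> > 0" for \<tau>
  proof -
    have nz: "\<tau> + 1 \<noteq> 0" using t by (metis add.right_neutral one_complex.sel(2) plus_complex.sel(2) less_irrefl zero_complex.sel(2))
    have "Im (\<tau> / (\<tau> + 1)) = Im \<tau> / (cmod (\<tau> + 1))\<^sup>2"
      by (simp add: Im_divide cmod_power2 algebra_simps)
    then have 1: "Im (\<tau> / (\<tau> + 1)) > 0" using t nz by simp
    have 2: "Im (\<tau> + 1) > 0" using t by simp
    let ?x = "csqrt (\<tau> / (\<tau> + 1)) * csqrt (\<tau> + 1)"
    have "Im ?x > 0"
      using csqrt_quadrant[OF 1] csqrt_quadrant[OF 2] by (simp del: csqrt.simps add: add_pos_pos)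
    have "?x\<^sup>2 = (csqrt \<tau>)\<^sup>2" using nz by (simp add: power_mult_distrib)
    then have "?x = csqrt \<tau> \<or> ?x = - csqrt \<tau>" by (simp only: power2_eq_iff)
    moreover have "?x \<noteq> - csqrt \<tau>"
      using \<open>Im ?x > 0\<close> csqrt_quadrant(2)[OF t] by (metis uminus_complex.sel(2) neg_0_less_iff_less less_asym)
    ultimately show ?thesis by blast
  qed
  have nz: "\<tau> + 1 \<noteq> 0" if "Im \<tau> > 0" for \<tau>
    using that by (metis add.right_neutral one_complex.sel(2) plus_complex.sel(2) less_irrefl zero_complex.sel(2))
  have im: "Im (\<tau> / (\<tau> + 1)) > 0" "Im ((- \<tau> - 1) / \<tau>) > 0" "Im (-1 / (\<tau> + 1)) > 0"
    if "Im \<tau> > 0" for \<tau>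
  proof -
    have "Im (\<tau> / (\<tau> + 1)) = Im \<tau> / (cmod (\<tau> + 1))\<^sup>2"
      "Im ((- \<tau> - 1) / \<tau>) = Im \<tau> / (cmod \<tau>)\<^sup>2"
      "Im (-1 / (\<tau> + 1)) = Im \<tau> / (cmod (\<tau> + 1))\<^sup>2"
      by (simp_all add: Im_divide cmod_power2 algebra_simps)
    moreover have "\<tau> \<noteq> 0" using that by auto
    ultimately show "Im (\<tau> / (\<tau> + 1)) > 0" "Im ((- \<tau> - 1) / \<tau>) > 0" "Im (-1 / (\<tau> + 1)) > 0"
      using that nz[OF that] by simp_all
  qed
  let ?T = "vector [vector [1, 1], vector [0, 1]] :: int^2^2"
  let ?S = "vector [vector [0, -1], vector [1, 0]] :: int^2^2"
  have act: "moebius_act ?T \<tau> = \<tau> + 1" "moebius_act (?S ** ?T) \<tau> = -1 / (\<tau> + 1)"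
    "moebius_act (?T ** (?S ** ?T)) \<tau> = \<tau> / (\<tau> + 1)"
    "moebius_act (?S ** (?T ** (?S ** ?T))) \<tau> = (- \<tau> - 1) / \<tau>"
    for \<tau>
    by (simp_all add: moebius_act_def mat2_mult_entries)
  show ?thesis
    unfolding Mp2_T_def Mp2_S_def Mp2Z_mult
    using im id
    by (auto simp: mat2_eq_iff mat2_mult_entries act upper_half_plane_def
      simp del: csqrt.simps intro!: restrict_ext)
qed

section \<open>The Weil representation of a subquotient\<close>

lemma sum_basis_vec:
  assumes "finite S"
  shows "(\<Sum>m\<in>S. c m * basis_vec m x) = (if x \<in> S then c x else 0)"
proof -
  have "(\<Sum>m\<in>S. c m * basis_vec m x) = (\<Sum>m\<in>S. if m = x then c m else 0)"
    by (intro sum.cong) (auto simp: basis_vec_def)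
  then show ?thesis using assms by simp
qed

lemma group_algebra_comb:
  "v \<in> group_algebra A \<Longrightarrow> w \<in> group_algebra A \<Longrightarrow> (\<lambda>x. a * v x + b * w x) \<in> group_algebra A"
  by (simp add: group_algebra_def)

lemma group_algebra_scale:
  "v \<in> group_algebra A \<Longrightarrow> (\<lambda>x. a * v x) \<in> group_algebra A"
  by (simp add: group_algebra_def)

lemma basis_vec_in: "l \<in> carrier A \<Longrightarrow> basis_vec l \<in> group_algebra A"
  by (auto simp: group_algebra_def basis_vec_def)

section \<open>Explicit action of the Weil representation and its Gauss sum\<close>

locale weil_representation = discriminant_form A for A :: "'a disc_form" (structure) +
  fixes \<rho>
  assumes weil: "is_weil_representation A \<rho>"
begin

lemma rho_Bij: "g \<in> carrier Mp2Z \<Longrightarrow> \<rho> g \<in> Bij (group_algebra A)"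
  using weil unfolding is_weil_representation_def hom_def BijGroup_def by auto

lemma rho_bij: "g \<in> carrier Mp2Z \<Longrightarrow> bij_betw (\<rho> g) (group_algebra A) (group_algebra A)"
  using rho_Bij by (simp add: Bij_def)

lemma rho_closed: "g \<in> carrier Mp2Z \<Longrightarrow> v \<in> group_algebra A \<Longrightarrow> \<rho> g v \<in> group_algebra A"
  using rho_bij bij_betwE by blast

lemma rho_mult:
  assumes "g \<in> carrier Mp2Z" "h \<in> carrier Mp2Z" "v \<in> group_algebra A"
  shows "\<rho> (g \<otimes>\<^bsub>Mp2Z\<^esub> h) v = \<rho> g (\<rho> h v)"
proof -
  have "\<rho> (g \<otimes>\<^bsub>Mp2Z\<^esub> h) = \<rho> g \<otimes>\<^bsub>BijGroup (group_algebra A)\<^esub> \<rho> h"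
    using weil assms unfolding is_weil_representation_def hom_def by auto
  also have "\<dots> = compose (group_algebra A) (\<rho> g) (\<rho> h)"
    using rho_Bij assms by (simp add: BijGroup_def)
  finally show ?thesis using assms(3) by (simp add: compose_def)
qed

lemma rho_comb:
  "\<lbrakk>g \<in> carrier Mp2Z; v \<in> group_algebra A; w \<in> group_algebra A\<rbrakk> \<Longrightarrow>
     \<rho> g (\<lambda>x. a * v x + b * w x) = (\<lambda>x. a * \<rho> g v x + b * \<rho> g w x)"
  using weil unfolding is_weil_representation_def by blast

lemma rho_scale:
  "\<lbrakk>g \<in> carrier Mp2Z; v \<in> group_algebra A\<rbrakk> \<Longrightarrow> \<rho> g (\<lambda>x. a * v x) = (\<lambda>x. a * \<rho> g v x)"
  using rho_comb[of g v v a 0] by simp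

text \<open>Membership in \<open>hom\<close> only gives multiplicativity. The operator of the unit
  is then idempotent, and being injective it is the identity.\<close>

lemma rho_one: "v \<in> group_algebra A \<Longrightarrow> \<rho> \<one>\<^bsub>Mp2Z\<^esub> v = v"
  using rho_mult[of "\<one>\<^bsub>Mp2Z\<^esub>" "\<one>\<^bsub>Mp2Z\<^esub>" v] rho_bij[of "\<one>\<^bsub>Mp2Z\<^esub>"]
    rho_closed[of "\<one>\<^bsub>Mp2Z\<^esub>" v] Mp2Z_one_closed Mp2Z_mult_one[OF Mp2Z_one_closed]
  by (auto simp: bij_betw_def dest: inj_onD)

lemma rho_expand:
  assumes g: "g \<in> carrier Mp2Z" and v: "v \<in> group_algebra A"
  shows "\<rho> g v = (\<lambda>x. \<Sum>l\<in>carrier A. v l * \<rho> g (basis_vec l) x)"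
proof -
  \<comment> \<open>Membership of the partial sums is carried through the induction because
    linearity is available only inside \<open>group_algebra A\<close>.\<close>
  have "\<rho> g (\<lambda>x. \<Sum>l\<in>F. v l * basis_vec l x) = (\<lambda>x. \<Sum>l\<in>F. v l * \<rho> g (basis_vec l) x)
      \<and> (\<lambda>x. \<Sum>l\<in>F. v l * basis_vec l x) \<in> group_algebra A"
    if "finite F" "F \<subseteq> carrier A" for F
    using that
  proof (induction F)
    case empty
    have "(\<lambda>x. 0) \<in> group_algebra A" by (simp add: group_algebra_def)
    then show ?case using rho_comb[OF g, of "\<lambda>x. 0" "\<lambda>x. 0" 0 0] by simp
  next
    case (insert l F)
    then have *: "basis_vec l \<in> group_algebra A" "(\<lambda>x. \<Sum>l\<in>F. v l * basis_vec l x) \<in> group_algebra A"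
      by (simp_all add: basis_vec_in)
    have "(\<lambda>x. \<Sum>l\<in>insert l F. v l * basis_vec l x)
        = (\<lambda>x. v l * basis_vec l x + 1 * (\<Sum>l\<in>F. v l * basis_vec l x))"
      using insert by simp
    then show ?case
      using insert rho_comb[OF g *, of "v l" 1] group_algebra_comb[OF *, of "v l" 1] by simp
  qed
  from this[OF finite_carrier subset_refl]
  have "\<rho> g (\<lambda>x. \<Sum>l\<in>carrier A. v l * basis_vec l x) = (\<lambda>x. \<Sum>l\<in>carrier A. v l * \<rho> g (basis_vec l) x)" ..
  moreover have "(\<lambda>x. \<Sum>l\<in>carrier A. v l * basis_vec l x) = v"
    using v by (auto simp: sum_basis_vec finite_carrier group_algebra_def)
  ultimately show ?thesis by simp
qed

lemma rho_T:
  assumes v: "v \<in> group_algebra A"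
  shows "\<rho> Mp2_T v = (\<lambda>x. e_class (quad A x) * v x)"
proof
  fix x
  have "\<rho> Mp2_T v x = (\<Sum>l\<in>carrier A. (v l * e_class (quad A l)) * basis_vec l x)"
    unfolding rho_expand[OF Mp2_T_closed v] using weil
    by (intro sum.cong) (auto simp: is_weil_representation_def)
  then show "\<rho> Mp2_T v x = e_class (quad A x) * v x"
    using v by (simp add: sum_basis_vec finite_carrier group_algebra_def)
qed

definition S_factor :: complex where
  "S_factor = e_fun (- of_int (signature A) / 8) / of_real (sqrt (card (carrier A)))"

lemma card_carrier_pos: "card (carrier A) > 0"
  using finite_carrier one_closed card_gt_0_iff by blast

lemma S_factor_nonzero: "S_factor \<noteq> 0"
  using card_carrier_pos by (simp add: S_factor_def)

lemma rho_S:
  assumes v: "v \<in> group_algebra A"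
  shows "\<rho> Mp2_S v = (\<lambda>x. if x \<in> carrier A then S_factor * (\<Sum>l\<in>carrier A. e_class (- bil A l x) * v l) else 0)"
proof
  fix x
  have "\<rho> Mp2_S v x = (\<Sum>l\<in>carrier A. v l * (S_factor * (\<Sum>m\<in>carrier A. e_class (- bil A l m) * basis_vec m x)))"
    unfolding rho_expand[OF Mp2_S_closed v] using weil
    by (intro sum.cong) (auto simp: is_weil_representation_def S_factor_def)
  then show "\<rho> Mp2_S v x = (if x \<in> carrier A then S_factor * (\<Sum>l\<in>carrier A. e_class (- bil A l x) * v l) else 0)"
    unfolding sum_basis_vec[OF finite_carrier] by (simp add: sum_distrib_left mult_ac)
qed

text \<open>Milgram's formula is not needed: the relation \<open>TSTST = S\<close> forces the Gauss sum to be
  the inverse of the normalising factor of \<open>\<rho> S\<close>.\<close>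

lemma gauss_sum: "S_factor * (\<Sum>x\<in>carrier A. e_class (quad A x)) = 1"
proof -
  let ?b = "basis_vec \<one> :: 'a \<Rightarrow> complex"
  note cl = Mp2_T_closed Mp2_S_closed Mp2Z_mult_closed rho_closed
  have b: "?b \<in> group_algebra A" by (simp add: basis_vec_in)
  have Tb: "\<rho> Mp2_T ?b = ?b" unfolding rho_T[OF b] by (auto simp: basis_vec_def)
  have Sb: "\<rho> Mp2_S ?b = (\<lambda>x. if x \<in> carrier A then S_factor else 0)"
    unfolding rho_S[OF b] using finite_carrier
    by (auto simp: basis_vec_def if_distrib[of "\<lambda>y. _ * y"] e_class_minus cong: if_cong)
  define u where "u = \<rho> Mp2_T (\<rho> Mp2_S ?b)"
  have u: "u \<in> group_algebra A" by (simp add: u_def cl b)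
  \<comment> \<open>The relation is applied to the basis vector of the neutral element, which
    \<open>T\<close> fixes, and evaluated there: one side is \<open>S_factor\<close>, the other its
    square times the Gauss sum.\<close>
  have "S_factor = \<rho> Mp2_S ?b \<one>" by (simp add: Sb)
  also have "\<dots> = \<rho> Mp2_T (\<rho> Mp2_S (\<rho> Mp2_T (\<rho> Mp2_S (\<rho> Mp2_T ?b)))) \<one>"
    by (subst Mp2Z_braid[symmetric]) (simp add: rho_mult cl b)
  also have "\<dots> = \<rho> Mp2_T (\<rho> Mp2_S u) \<one>"
    by (simp add: Tb u_def)
  also have "\<dots> = S_factor * (\<Sum>l\<in>carrier A. e_class (- bil A l \<one>) * u l)"
    unfolding rho_T[OF rho_closed[OF Mp2_S_closed u]] unfolding rho_S[OF u] by simp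
  also have "u = (\<lambda>x. e_class (quad A x) * \<rho> Mp2_S ?b x)"
    unfolding u_def by (rule rho_T[OF rho_closed[OF Mp2_S_closed b]])
  also have "S_factor * (\<Sum>l\<in>carrier A. e_class (- bil A l \<one>) * (e_class (quad A l) * \<rho> Mp2_S ?b l))
      = S_factor * (S_factor * (\<Sum>l\<in>carrier A. e_class (quad A l)))"
    by (simp add: Sb sum_distrib_left mult_ac)
  finally show ?thesis using S_factor_nonzero by simp
qed

end

section \<open>Subquotient and arrow operators of an isotropic subgroup\<close>

locale isotropic_subgroup = discriminant_form A for A :: "'a disc_form" (structure) +
  fixes H
  assumes subgroup_H: "subgroup H A"
    and isotropic: "h \<in> H \<Longrightarrow> quad A h = 0"
begin

abbreviation D where "D \<equiv> subquotient A H"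

lemma H_carrier: "h \<in> H \<Longrightarrow> h \<in> carrier A"
  using subgroup.mem_carrier[OF subgroup_H] .

lemma H_subset: "H \<subseteq> carrier A"
  using H_carrier by blast

lemma finite_H: "finite H"
  using finite_subset[OF H_subset finite_carrier] .

lemma card_H_pos: "card H > 0"
  using finite_H subgroup.one_closed[OF subgroup_H] card_gt_0_iff by blast

lemma orth_mem: "x \<in> orth A H \<Longrightarrow> x \<in> carrier A"
  by (simp add: orth_def)

lemma finite_orth: "finite (orth A H)"
  using orth_mem finite_subset[OF _ finite_carrier] by blast

lemma bil_H: "h \<in> H \<Longrightarrow> x \<in> orth A H \<Longrightarrow> bil A h x = 0"
  by (simp add: orth_def)

lemma H_orth: "h \<in> H \<Longrightarrow> h \<in> orth A H"
  by (auto simp: orth_def bil_def H_carrier isotropic subgroup.m_closed[OF subgroup_H])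

lemma orth_mult: "x \<in> orth A H \<Longrightarrow> y \<in> orth A H \<Longrightarrow> x \<otimes> y \<in> orth A H"
  by (auto simp: orth_def bil_mult_right H_carrier)

lemma orth_H_mult_iff: "h \<in> H \<Longrightarrow> x \<in> carrier A \<Longrightarrow> h \<otimes> x \<in> orth A H \<longleftrightarrow> x \<in> orth A H"
  using bil_H[OF _ H_orth] by (auto simp: orth_def bil_mult_right H_carrier)

lemma quad_H_mult: "h \<in> H \<Longrightarrow> x \<in> orth A H \<Longrightarrow> quad A (h \<otimes> x) = quad A x"
  by (simp add: quad_mult_isotropic isotropic bil_H)

lemma coset_self: "x \<in> carrier A \<Longrightarrow> x \<in> H #> x"
  using rcos_self[OF _ subgroup_H] .

lemma coset_eq: "x \<in> carrier A \<Longrightarrow> y \<in> H #> x \<Longrightarrow> H #> y = H #> x"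
  using repr_independence[OF _ _ subgroup_H] by simp

lemma mem_coset_iff: "x \<in> carrier A \<Longrightarrow> y \<in> H #> x \<longleftrightarrow> (\<exists>h\<in>H. y = h \<otimes> x)"
  by (auto simp: r_coset_def)

lemma coset_orth: "x \<in> orth A H \<Longrightarrow> y \<in> H #> x \<Longrightarrow> y \<in> orth A H"
  using orth_H_mult_iff mem_coset_iff orth_mem by auto

lemma sum_coset:
  assumes "x \<in> carrier A"
  shows "sum f (H #> x) = (\<Sum>h\<in>H. f (h \<otimes> x))"
proof -
  have "H #> x = (\<lambda>h. h \<otimes> x) ` H" by (auto simp: r_coset_def)
  moreover have "inj_on (\<lambda>h. h \<otimes> x) H"
    using assms by (auto simp: inj_on_def H_carrier)
  ultimately show ?thesis by (simp add: sum.reindex)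
qed

lemma card_coset: "x \<in> carrier A \<Longrightarrow> card (H #> x) = card H"
  using sum_coset[of x "\<lambda>_. 1 :: nat"] by simp

lemma carrier_D: "carrier D = (\<lambda>x. H #> x) ` orth A H"
  by (auto simp: subquotient_simps)

lemma coset_in_D: "x \<in> orth A H \<Longrightarrow> H #> x \<in> carrier D"
  by (simp add: carrier_D)

lemma finite_D: "finite (carrier D)"
  by (simp add: carrier_D finite_orth)

text \<open>The quadratic form takes a single value on the coset, which gives
  \<open>the_elem\<close> its meaning.\<close>

lemma quad_D:
  assumes "x \<in> orth A H"
  shows "quad D (H #> x) = quad A x"
proof -
  have "quad A ` (H #> x) = {quad A x}"
    using assms by (auto simp: mem_coset_iff orth_mem quad_H_mult
        intro: rev_image_eqI[OF coset_self])
  then show ?thesis by (simp add: subquotient_simps)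
qed

lemma mult_D:
  assumes "x \<in> orth A H" "y \<in> orth A H"
  shows "(H #> x) \<otimes>\<^bsub>D\<^esub> (H #> y) = H #> (x \<otimes> y)"
proof -
  have "(H #> x) \<otimes>\<^bsub>D\<^esub> (H #> y) = (H #> x) <#> (H #> y)"
    by (simp add: subquotient_def monoid.defs disc_form.defs FactGroup_def set_mult_def)
  also have "\<dots> = H #> (x \<otimes> y)"
    using normal.rcos_sum[OF subgroup_imp_normal[OF subgroup_H]] assms by (simp add: orth_mem)
  finally show ?thesis .
qed

lemma bil_D:
  assumes "x \<in> orth A H" "y \<in> orth A H"
  shows "bil D (H #> x) (H #> y) = bil A x y"
  using assms by (simp add: bil_def mult_D quad_D orth_mult)

lemma sum_D: "(\<Sum>C\<in>carrier D. sum f C) = sum f (orth A H)"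
proof -
  have "sum f (orth A H) = (\<Sum>C\<in>carrier D. sum f {x \<in> orth A H. H #> x = C})"
    unfolding carrier_D by (rule sum.image_gen[OF finite_orth])
  also have "\<dots> = (\<Sum>C\<in>carrier D. sum f C)"
  proof (rule sum.cong[OF refl])
    fix C assume "C \<in> carrier D"
    then obtain y where y: "y \<in> orth A H" "C = H #> y" by (auto simp: carrier_D)
    have "{x \<in> orth A H. H #> x = C} = C"
      using y coset_self[OF orth_mem] coset_orth coset_eq[OF orth_mem] by blast
    then show "sum f {x \<in> orth A H. H #> x = C} = sum f C" by simp
  qed
  finally show ?thesis ..
qed

lemma card_D: "card (carrier D) * (card H)\<^sup>2 = card (carrier A)"
proof -
  have "card (orth A H) = (\<Sum>C\<in>carrier D. card C)"
    using sum_D[of "\<lambda>_. 1 :: nat"] by simp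
  also have "\<dots> = (\<Sum>C\<in>carrier D. card H)"
    by (intro sum.cong) (auto simp: carrier_D card_coset orth_mem)
  finally show ?thesis
    using card_orth[OF subgroup_H] by (simp add: power2_eq_square mult_ac)
qed

text \<open>Averaging the Gauss sum of \<open>A\<close> over translations by \<open>H\<close>
  inserts the character sum of \<open>H\<close>, which removes everything outside the orthogonal
  complement; on the complement the summand is constant on cosets. This links the signatures of
  \<open>A\<close> and \<open>D\<close>.\<close>

lemma gauss_sum_D:
  "(\<Sum>x\<in>carrier A. e_class (quad A x)) = of_nat (card H) * (\<Sum>C\<in>carrier D. e_class (quad D C))"
proof -
  let ?G = "\<Sum>x\<in>carrier A. e_class (quad A x)"
  have "of_nat (card H) * ?G = (\<Sum>h\<in>H. \<Sum>x\<in>carrier A. e_class (quad A (h \<otimes> x)))"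
  proof -
    have "(\<Sum>x\<in>carrier A. e_class (quad A (h \<otimes> x))) = ?G" if "h \<in> H" for h
      by (rule sum.reindex_bij_witness[of _ "\<lambda>x. inv h \<otimes> x" "\<lambda>x. h \<otimes> x"])
         (use that H_carrier in \<open>auto simp: m_assoc[symmetric]\<close>)
    then show ?thesis by simp
  qed
  also have "\<dots> = (\<Sum>x\<in>carrier A. \<Sum>h\<in>H. e_class (quad A (h \<otimes> x)))"
    by (rule sum.swap)
  also have "\<dots> = (\<Sum>x\<in>carrier A. e_class (quad A x) * (\<Sum>h\<in>H. e_class (bil A h x)))"
    by (simp add: quad_mult isotropic e_class_add sum_distrib_left)
  also have "\<dots> = (\<Sum>x\<in>carrier A. if x \<in> orth A H then of_nat (card H) * e_class (quad A x) else 0)"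
    by (intro sum.cong) (auto simp: sum_character[OF subgroup_H])
  also have "\<dots> = (\<Sum>x\<in>orth A H. of_nat (card H) * e_class (quad A x))"
    by (rule sum.mono_neutral_cong_right) (auto simp: finite_carrier orth_def)
  also have "\<dots> = (\<Sum>C\<in>carrier D. \<Sum>x\<in>C. of_nat (card H) * e_class (quad A x))"
    by (rule sum_D[symmetric])
  also have "\<dots> = (\<Sum>C\<in>carrier D. of_nat (card H) * (of_nat (card H) * e_class (quad D C)))"
    by (intro sum.cong refl)
       (auto simp: carrier_D sum_coset orth_mem quad_H_mult quad_D)
  finally show ?thesis
    using card_H_pos by (simp add: sum_distrib_left[symmetric])
qed

definition up :: "('a set \<Rightarrow> complex) \<Rightarrow> 'a \<Rightarrow> complex" where
  "up w = (\<lambda>x. if x \<in> orth A H then w (H #> x) else 0)"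

text \<open>The arrow down sums over a coset instead of averaging, which makes it the transpose of
  \<open>up\<close>. The price is the factor \<open>card H\<close> in
  \<open>down_up\<close>.\<close>

definition down :: "('a \<Rightarrow> complex) \<Rightarrow> 'a set \<Rightarrow> complex" where
  "down v = (\<lambda>C. if C \<in> carrier D then \<Sum>x\<in>C. v x else 0)"

lemma up_arrow_eq: "up_arrow A H g \<tau> = up (g \<tau>)"
  by (auto simp: up_arrow_def up_def sum_basis_vec finite_orth)

lemma up_closed: "up w \<in> group_algebra A"
  by (auto simp: up_def group_algebra_def orth_mem)

lemma down_closed: "down v \<in> group_algebra D"
  by (auto simp: down_def group_algebra_def)

lemma up_comb: "up (\<lambda>C. a * v C + b * w C) = (\<lambda>x. a * up v x + b * up w x)"
  by (auto simp: up_def)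

lemma up_scale: "up (\<lambda>C. a * v C) = (\<lambda>x. a * up v x)"
  by (auto simp: up_def)

lemma down_comb: "down (\<lambda>C. a * v C + b * w C) = (\<lambda>x. a * down v x + b * down w x)"
  by (auto simp: down_def sum.distrib sum_distrib_left)

lemma down_scale: "down (\<lambda>C. a * v C) = (\<lambda>x. a * down v x)"
  by (auto simp: down_def sum_distrib_left)

lemma up_inject:
  assumes "v \<in> group_algebra D" "w \<in> group_algebra D" "up v = up w"
  shows "v = w"
proof
  fix C
  show "v C = w C"
  proof (cases "C \<in> carrier D")
    case True
    then obtain x where "x \<in> orth A H" "C = H #> x" by (auto simp: carrier_D)
    then show ?thesis using fun_cong[OF assms(3), of x] by (simp add: up_def)
  next
    case False
    then show ?thesis using assms by (simp add: group_algebra_def)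
  qed
qed

text \<open>\<open>up w\<close> is constant on each coset, and every coset has \<open>card H\<close>
  elements.\<close>

lemma down_up:
  assumes "w \<in> group_algebra D"
  shows "down (up w) = (\<lambda>C. of_nat (card H) * w C)"
proof
  fix C
  show "down (up w) C = of_nat (card H) * w C"
  proof (cases "C \<in> carrier D")
    case True
    then obtain x where x: "x \<in> orth A H" "C = H #> x" by (auto simp: carrier_D)
    have "sum (up w) C = (\<Sum>y\<in>C. w C)"
    proof (rule sum.cong[OF refl])
      fix y assume "y \<in> C"
      then have y: "y \<in> H #> x" using x by simp
      show "up w y = w C"
        using coset_orth[OF x(1) y] coset_eq[OF orth_mem[OF x(1)] y] x(2) by (simp add: up_def)
    qed
    then show ?thesis using True x by (simp add: down_def card_coset orth_mem)
  next
    case False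
    then show ?thesis using assms by (simp add: group_algebra_def down_def)
  qed
qed

text \<open>For \<open>H\<close> the subgroup \<open>I_sub A e d\<close> with \<open>d\<close>
  dividing the order of \<open>e\<close>, this is \<open>d\<close> times the operator
  \<open>P\<^sub>d\<close>.\<close>

lemma up_down: "up (down v) x = (if x \<in> orth A H then \<Sum>h\<in>H. v (h \<otimes> x) else 0)"
  by (simp add: up_def down_def coset_in_D sum_coset orth_mem)

end

section \<open>Descent of the Weil representation to the subquotient\<close>

locale isotropic_weil = isotropic_subgroup A H + weil_representation A \<rho>
  for A :: "'a disc_form" (structure) and H \<rho>
begin

lemma T_commutes:
  assumes v: "v \<in> group_algebra A"
  shows "up (down (\<rho> Mp2_T v)) = \<rho> Mp2_T (up (down v))"
  unfolding rho_T[OF v] rho_T[OF up_closed] up_down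
  by (auto simp: quad_H_mult sum_distrib_left)

text \<open>Both sides reduce to a sum over the orthogonal complement of \<open>H\<close>. On the
  left the sum over \<open>H\<close> is a character sum in \<open>l\<close> and restricts
  \<open>l\<close> to the complement; on the right it is a character sum in \<open>x\<close> and
  makes the result vanish off the complement.\<close>

lemma S_commutes:
  assumes v: "v \<in> group_algebra A"
  shows "up (down (\<rho> Mp2_S v)) = \<rho> Mp2_S (up (down v))"
proof
  fix x
  show "up (down (\<rho> Mp2_S v)) x = \<rho> Mp2_S (up (down v)) x"
  proof (cases "x \<in> carrier A")
    case False
    then show ?thesis using rho_closed[OF Mp2_S_closed up_closed] up_closed
      by (simp add: group_algebra_def)
  next
    case x: True
    have R: "\<rho> Mp2_S (up (down v)) x =
       S_factor * ((\<Sum>h\<in>H. e_class (bil A h x)) * (\<Sum>l\<in>orth A H. e_class (- bil A l x) * v l))"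
    proof -
      have "(\<Sum>l\<in>carrier A. e_class (- bil A l x) * up (down v) l)
          = (\<Sum>l\<in>orth A H. e_class (- bil A l x) * (\<Sum>h\<in>H. v (h \<otimes> l)))"
        unfolding up_down by (rule sum.mono_neutral_cong_right) (auto simp: finite_carrier orth_def)
      also have "\<dots> = (\<Sum>h\<in>H. \<Sum>l\<in>orth A H. e_class (- bil A l x) * v (h \<otimes> l))"
        unfolding sum_distrib_left by (rule sum.swap)
      \<comment> \<open>Translating \<open>l\<close> by \<open>h\<close> moves the shift from
        \<open>v\<close> to the character, where it splits off as a factor depending only on
        \<open>h\<close> and \<open>x\<close>.\<close>
      also have "\<dots> = (\<Sum>h\<in>H. \<Sum>l\<in>orth A H. e_class (bil A h x) * (e_class (- bil A l x) * v l))"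
      proof (rule sum.cong[OF refl])
        fix h assume h: "h \<in> H"
        have ih: "inv h \<in> H" using h subgroup.m_inv_closed[OF subgroup_H] by simp
        show "(\<Sum>l\<in>orth A H. e_class (- bil A l x) * v (h \<otimes> l)) =
          (\<Sum>l\<in>orth A H. e_class (bil A h x) * (e_class (- bil A l x) * v l))"
          by (rule sum.reindex_bij_witness[of _ "\<lambda>l. inv h \<otimes> l" "\<lambda>l. h \<otimes> l"])
             (use h ih in \<open>auto simp: m_assoc[symmetric] H_carrier orth_mem orth_H_mult_iff bil_mult_left x
               e_class_add[symmetric]\<close>)
      qed
      also have "\<dots> = (\<Sum>h\<in>H. e_class (bil A h x)) * (\<Sum>l\<in>orth A H. e_class (- bil A l x) * v l)"
        by (simp add: sum_product)
      finally show ?thesis by (simp add: rho_S up_closed x)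
    qed
    show ?thesis
    proof (cases "x \<in> orth A H")
      case False
      then show ?thesis unfolding R up_down by (simp add: sum_character[OF subgroup_H x])
    next
      case True
      have hx: "h \<otimes> x \<in> carrier A" if "h \<in> H" for h using that x H_carrier by simp
      have "up (down (\<rho> Mp2_S v)) x =
          (\<Sum>h\<in>H. S_factor * (\<Sum>l\<in>carrier A. e_class (- bil A l (h \<otimes> x)) * v l))"
        using True hx by (simp add: up_down rho_S[OF v])
      also have "\<dots> = S_factor * (\<Sum>h\<in>H. \<Sum>l\<in>carrier A. e_class (- bil A l (h \<otimes> x)) * v l)"
        by (simp add: sum_distrib_left)
      also have "(\<Sum>h\<in>H. \<Sum>l\<in>carrier A. e_class (- bil A l (h \<otimes> x)) * v l) =
          (\<Sum>l\<in>carrier A. \<Sum>h\<in>H. e_class (- bil A l (h \<otimes> x)) * v l)"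
        by (rule sum.swap)
      also have "\<dots> = (\<Sum>l\<in>carrier A. (\<Sum>h\<in>H. e_class (bil A (inv h) l)) * (e_class (- bil A l x) * v l))"
      proof -
        have "- bil A l (h \<otimes> x) = bil A (inv h) l + - bil A l x" if "l \<in> carrier A" "h \<in> H" for l h
          using that x by (simp add: H_carrier bil_mult_right bil_inv_left bil_sym[of h l])
        then show ?thesis
          unfolding sum_distrib_right
          by (intro sum.cong refl) (simp only: e_class_add mult_ac)
      qed
      also have "\<dots> = (\<Sum>l\<in>carrier A. (\<Sum>h\<in>H. e_class (bil A h l)) * (e_class (- bil A l x) * v l))"
      proof -
        have "(\<Sum>h\<in>H. e_class (bil A (inv h) l)) = (\<Sum>h\<in>H. e_class (bil A h l))" for l
          by (rule sum.reindex_bij_witness[of _ "\<lambda>h. inv h" "\<lambda>h. inv h"])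
             (auto simp: H_carrier subgroup.m_inv_closed[OF subgroup_H])
        then show ?thesis by simp
      qed
      also have "\<dots> = (\<Sum>l\<in>orth A H. of_nat (card H) * (e_class (- bil A l x) * v l))"
        by (rule sum.mono_neutral_cong_right)
           (auto simp: finite_carrier orth_mem sum_character[OF subgroup_H])
      finally show ?thesis
        unfolding R using True by (simp add: sum_character[OF subgroup_H x] sum_distrib_left)
    qed
  qed
qed

text \<open>If the operator of \<open>s\<close> commutes with the arrows, then commuting for
  \<open>g\<close> and for the product of \<open>g\<close> and \<open>s\<close> are equivalent; one
  direction uses that the operator of \<open>s\<close> is surjective. This is the form required by
  \<open>Mp2Z_generators\<close>.\<close>

lemma rho_commutes:
  assumes "g \<in> carrier Mp2Z" "v \<in> group_algebra A"
  shows "up (down (\<rho> g v)) = \<rho> g (up (down v))"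
proof -
  let ?P = "\<lambda>g. \<forall>v\<in>group_algebra A. up (down (\<rho> g v)) = \<rho> g (up (down v))"
  have step: "?P (g \<otimes>\<^bsub>Mp2Z\<^esub> s) \<longleftrightarrow> ?P g"
    if g: "g \<in> carrier Mp2Z" and s: "s \<in> carrier Mp2Z" "?P s" for g s
  proof
    assume "?P g"
    then show "?P (g \<otimes>\<^bsub>Mp2Z\<^esub> s)" using g s rho_closed up_closed by (simp add: rho_mult)
  next
    assume gs: "?P (g \<otimes>\<^bsub>Mp2Z\<^esub> s)"
    show "?P g"
    proof
      fix v assume "v \<in> group_algebra A"
      then obtain w where w: "w \<in> group_algebra A" "v = \<rho> s w"
        using rho_bij[OF s(1)] by (auto simp: bij_betw_def)
      then show "up (down (\<rho> g v)) = \<rho> g (up (down v))"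
        using gs g s up_closed by (simp add: rho_mult)
    qed
  qed
  have "?P g"
    by (rule Mp2Z_generators[OF assms(1)])
       (use step T_commutes S_commutes Mp2_T_closed Mp2_S_closed in \<open>simp_all add: rho_one up_closed\<close>)
  then show ?thesis using assms(2) by blast
qed

text \<open>Equality of the signatures modulo 8. The relation \<open>gauss_sum\<close> for
  \<open>A\<close> determines the Gauss sum of \<open>D\<close> through \<open>gauss_sum_D\<close>,
  and the order of \<open>D\<close> accounts for the factor \<open>card H\<close>.\<close>

lemma S_factor_D:
  "e_fun (- of_int (signature D) / 8) / of_real (sqrt (card (carrier D))) = of_nat (card H) * S_factor"
proof -
  have sq: "sqrt (card (carrier A)) = sqrt (card (carrier D)) * card H"
    unfolding card_D[symmetric] by (simp add: real_sqrt_mult)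
  have Dpos: "card (carrier D) > 0" using card_D card_carrier_pos by (metis gr0I mult_is_0 less_irrefl)
  have G1: "of_nat (card H) * S_factor * (\<Sum>C\<in>carrier D. e_class (quad D C)) = 1"
    using gauss_sum unfolding gauss_sum_D by (simp add: mult_ac)
  have HS: "of_nat (card H) * S_factor =
      e_fun (- of_int (signature A) / 8) / of_real (sqrt (card (carrier D)))"
    using card_H_pos by (simp add: S_factor_def sq)
  have G2: "of_nat (card H) * S_factor *
      (of_real (sqrt (card (carrier D))) * e_fun (of_int (signature A) / 8)) = 1"
    unfolding HS using Dpos by (simp add: e_fun_minus)
  have G: "(\<Sum>C\<in>carrier D. e_class (quad D C)) =
      of_real (sqrt (card (carrier D))) * e_fun (of_int (signature A) / 8)"
    using G1 G2 by (metis mult_left_cancel mult_eq_0_iff zero_neq_one)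
  \<comment> \<open>The number \<open>signature A\<close> is a witness for the choice that defines
    \<open>signature D\<close>, so the chosen value satisfies the defining equation.\<close>
  then have "(\<Sum>C\<in>carrier D. e_class (quad D C)) =
      of_real (sqrt (card (carrier D))) * e_fun (of_int (signature D) / 8)"
    unfolding signature_def[of D] by (rule someI)
  then have "e_fun (of_int (signature D) / 8) = e_fun (of_int (signature A) / 8)"
    using G Dpos by simp
  then show ?thesis unfolding HS by (simp add: e_fun_minus)
qed

text \<open>Conjugation by the arrows, normalised by \<open>down_up\<close>. It is restricted to
  \<open>group_algebra D\<close> because the elements of \<open>BijGroup\<close> are
  extensional.\<close>

definition rho_D where
  "rho_D g = (\<lambda>w\<in>group_algebra D. \<lambda>C. down (\<rho> g (up w)) C / of_nat (card H))"

lemma rho_D_apply: "w \<in> group_algebra D \<Longrightarrow> rho_D g w = (\<lambda>C. 1 / of_nat (card H) * down (\<rho> g (up w)) C)"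
  by (simp add: rho_D_def)

lemma rho_D_closed: "w \<in> group_algebra D \<Longrightarrow> rho_D g w \<in> group_algebra D"
  by (simp only: rho_D_apply group_algebra_scale[OF down_closed])

text \<open>The arrow down intertwines the two representations: \<open>rho_commutes\<close> moves
  \<open>up\<close> and \<open>down\<close> past the operator, and the resulting
  \<open>card H\<close> cancels the normalisation.\<close>

lemma rho_D_down:
  assumes "g \<in> carrier Mp2Z" "v \<in> group_algebra A"
  shows "rho_D g (down v) = down (\<rho> g v)"
  using card_H_pos by (simp add: rho_D_apply down_closed rho_commutes[OF assms, symmetric] down_up)

lemma rho_D_comb:
  assumes "g \<in> carrier Mp2Z" "v \<in> group_algebra D" "w \<in> group_algebra D"
  shows "rho_D g (\<lambda>x. a * v x + b * w x) = (\<lambda>x. a * rho_D g v x + b * rho_D g w x)"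
  using assms
  by (simp add: rho_D_apply group_algebra_comb up_comb rho_comb up_closed down_comb add_divide_distrib)

lemma rho_D_scale:
  "\<lbrakk>g \<in> carrier Mp2Z; v \<in> group_algebra D\<rbrakk> \<Longrightarrow> rho_D g (\<lambda>x. a * v x) = (\<lambda>x. a * rho_D g v x)"
  using rho_D_comb[of g v v a 0] by simp

text \<open>Injectivity is inherited through \<open>up\<close>, which is injective and intertwining.
  A preimage of \<open>w\<close> is obtained by lifting to \<open>up w\<close>, taking a preimage
  under the operator on \<open>A\<close>, and applying \<open>down\<close> divided by
  \<open>card H\<close>.\<close>

lemma rho_D_bij:
  assumes g: "g \<in> carrier Mp2Z"
  shows "bij_betw (rho_D g) (group_algebra D) (group_algebra D)"
  unfolding bij_betw_def
proof
  have up: "up (rho_D g w) = \<rho> g (up w)" if w: "w \<in> group_algebra D" for w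
    using card_H_pos
    by (simp only: rho_D_apply[OF w] up_scale rho_commutes[OF g up_closed] down_up[OF w] rho_scale[OF g up_closed])
       simp
  show "inj_on (rho_D g) (group_algebra D)"
  proof (rule inj_onI)
    fix v w assume vw: "v \<in> group_algebra D" "w \<in> group_algebra D" "rho_D g v = rho_D g w"
    then have "\<rho> g (up v) = \<rho> g (up w)" using up by metis
    then have "up v = up w" using rho_bij[OF g] up_closed by (auto simp: bij_betw_def dest: inj_onD)
    then show "v = w" using up_inject vw by blast
  qed
  have "w \<in> rho_D g ` group_algebra D" if w: "w \<in> group_algebra D" for w
  proof -
    obtain v where v: "v \<in> group_algebra A" "\<rho> g v = up w"
      using rho_bij[OF g] up_closed[of w] unfolding bij_betw_def by (metis imageE)
    have "rho_D g (\<lambda>C. 1 / of_nat (card H) * down v C) = (\<lambda>C. 1 / of_nat (card H) * down (up w) C)"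
      by (simp only: rho_D_scale[OF g down_closed] rho_D_down[OF g v(1)] v(2))
    also have "\<dots> = w"
      using card_H_pos by (simp add: down_up[OF w])
    finally show ?thesis
      by (rule rev_image_eqI[OF group_algebra_scale[OF down_closed] sym])
  qed
  then show "rho_D g ` group_algebra D = group_algebra D" using rho_D_closed by blast
qed

lemma up_basis_vec:
  assumes x: "x \<in> orth A H"
  shows "up (basis_vec (H #> x)) = (\<lambda>y. if y \<in> H #> x then 1 else 0)"
proof
  fix y
  have "y \<in> orth A H \<and> H #> y = H #> x \<longleftrightarrow> y \<in> H #> x"
    using coset_self[OF orth_mem, of y] coset_orth[OF x, of y] coset_eq[OF orth_mem[OF x], of y] by metis
  then show "up (basis_vec (H #> x)) y = (if y \<in> H #> x then 1 else 0)"
    by (auto simp: up_def basis_vec_def)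
qed

text \<open>On generators, \<open>up\<close> of a basis vector is the indicator function of a coset.
  \<open>T\<close> acts on it by a scalar as the quadratic form is constant there; under
  \<open>S\<close> the coset contributes \<open>card H\<close>, which \<open>S_factor_D\<close>
  absorbs into the normalising factor of \<open>D\<close>.\<close>

lemma weil_D: "is_weil_representation D rho_D"
  unfolding is_weil_representation_def
proof (intro conjI ballI allI)
  have Bij: "rho_D g \<in> Bij (group_algebra D)" if "g \<in> carrier Mp2Z" for g
    using rho_D_bij[OF that] by (simp add: Bij_def rho_D_def)
  show "rho_D \<in> hom Mp2Z (BijGroup (group_algebra D))"
  proof (rule homI)
    fix g h assume gh: "g \<in> carrier Mp2Z" "h \<in> carrier Mp2Z"
    have "rho_D (g \<otimes>\<^bsub>Mp2Z\<^esub> h) w = compose (group_algebra D) (rho_D g) (rho_D h) w" for w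
    proof (cases "w \<in> group_algebra D")
      case True
      have "rho_D g (rho_D h w) = (\<lambda>C. 1 / of_nat (card H) * down (\<rho> g (\<rho> h (up w))) C)"
        by (simp only: rho_D_apply[OF True, of h] rho_D_scale[OF gh(1) down_closed]
          rho_D_down[OF gh(1) rho_closed[OF gh(2) up_closed]])
      also have "\<dots> = rho_D (g \<otimes>\<^bsub>Mp2Z\<^esub> h) w"
        by (simp only: rho_D_apply[OF True] rho_mult[OF gh up_closed])
      finally show ?thesis
        using True by (simp add: compose_def)
    next
      case False
      then show ?thesis by (simp add: rho_D_def compose_def)
    qed
    then show "rho_D (g \<otimes>\<^bsub>Mp2Z\<^esub> h) = rho_D g \<otimes>\<^bsub>BijGroup (group_algebra D)\<^esub> rho_D h"
      using Bij gh by (auto simp: BijGroup_def)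
  qed (simp add: BijGroup_def Bij)
next
  fix g v w a b
  assume "g \<in> carrier Mp2Z" "v \<in> group_algebra D" "w \<in> group_algebra D"
  then show "rho_D g (\<lambda>x. a * v x + b * w x) = (\<lambda>x. a * rho_D g v x + b * rho_D g w x)"
    by (rule rho_D_comb)
next
  fix C assume C: "C \<in> carrier D"
  then obtain x where x: "x \<in> orth A H" "C = H #> x" by (auto simp: carrier_D)
  have "\<rho> Mp2_T (up (basis_vec C)) = up (\<lambda>B. e_class (quad D C) * basis_vec C B)"
    unfolding rho_T[OF up_closed] up_scale
    using x by (auto simp: fun_eq_iff up_basis_vec quad_D mem_coset_iff orth_mem quad_H_mult)
  then show "rho_D Mp2_T (basis_vec C) = (\<lambda>B. e_class (quad D C) * basis_vec C B)"
    using C card_H_pos by (simp add: rho_D_apply basis_vec_in down_up group_algebra_scale)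
next
  fix C assume C: "C \<in> carrier D"
  then obtain x where x: "x \<in> orth A H" "C = H #> x" by (auto simp: carrier_D)
  let ?w = "\<lambda>B. of_nat (card H) * S_factor * (if B \<in> carrier D then e_class (- bil D C B) else 0)"
  have bilD: "bil D C (H #> y) = bil A x y" if "y \<in> orth A H" for y using that x bil_D by simp
  have S: "\<rho> Mp2_S (up (basis_vec C)) y = of_nat (card H) * S_factor * e_class (- bil A x y)" if y: "y \<in> orth A H" for y
  proof -
    have "\<rho> Mp2_S (up (basis_vec C)) y = S_factor * (\<Sum>l\<in>carrier A. e_class (- bil A l y) * up (basis_vec C) l)"
      by (simp add: rho_S[OF up_closed] orth_mem y)
    also have "(\<Sum>l\<in>carrier A. e_class (- bil A l y) * up (basis_vec C) l) = (\<Sum>l\<in>H #> x. e_class (- bil A l y))"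
      using x coset_orth orth_mem
      by (intro sum.mono_neutral_cong_right) (auto simp: finite_carrier up_basis_vec)
    also have "\<dots> = (\<Sum>h\<in>H. e_class (- bil A x y))"
      unfolding sum_coset[OF orth_mem[OF x(1)]]
      using x y by (intro sum.cong) (auto simp: bil_mult_left H_carrier orth_mem bil_H)
    finally show ?thesis by (simp add: mult_ac)
  qed
  \<comment> \<open>A second factor \<open>card H\<close> arises from summing over the target coset;
    it is the one that \<open>rho_D\<close> divides out.\<close>
  have "down (\<rho> Mp2_S (up (basis_vec C))) = (\<lambda>B. of_nat (card H) * ?w B)"
  proof
    fix B
    show "down (\<rho> Mp2_S (up (basis_vec C))) B = of_nat (card H) * ?w B"
    proof (cases "B \<in> carrier D")
      case True
      then obtain y where y: "y \<in> orth A H" "B = H #> y" by (auto simp: carrier_D)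
      have "(\<Sum>z\<in>B. \<rho> Mp2_S (up (basis_vec C)) z) = (\<Sum>z\<in>B. ?w B)"
      proof (rule sum.cong[OF refl])
        fix z assume "z \<in> B"
        then have z: "z \<in> H #> y" using y by simp
        have "bil D C B = bil A x z"
          using bilD[OF coset_orth[OF y(1) z]] coset_eq[OF orth_mem[OF y(1)] z] y(2) by simp
        then show "\<rho> Mp2_S (up (basis_vec C)) z = ?w B"
          using True S[OF coset_orth[OF y(1) z]] by simp
      qed
      then show ?thesis using True y by (simp add: down_def card_coset orth_mem)
    qed (simp add: down_def)
  qed
  then have "rho_D Mp2_S (basis_vec C) = ?w"
    using C card_H_pos by (simp add: rho_D_apply basis_vec_in)
  then show "rho_D Mp2_S (basis_vec C) = (\<lambda>B. e_fun (- of_int (signature D) / 8) / of_real (sqrt (card (carrier D))) *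
      (\<Sum>m\<in>carrier D. e_class (- bil D C m) * basis_vec m B))"
    unfolding S_factor_D sum_basis_vec[OF finite_D] .
qed

end

section \<open>Closure properties of holomorphy at the cusp\<close>

lemma holomorphic_at_cusp_zero: "holomorphic_at_cusp (\<lambda>_. 0)"
  unfolding holomorphic_at_cusp_def by (intro exI[of _ 1] conjI exI[of _ "\<lambda>_. 0"]) auto

lemma holomorphic_at_cusp_scale:
  assumes "holomorphic_at_cusp h"
  shows "holomorphic_at_cusp (\<lambda>\<tau>. c * h \<tau>)"
proof -
  obtain N F where "N > 0" "F holomorphic_on ball 0 1" "\<forall>\<tau>\<in>upper_half_plane. h \<tau> = F (e_fun (\<tau> / of_nat N))"
    using assms unfolding holomorphic_at_cusp_def by blast
  then show ?thesis unfolding holomorphic_at_cusp_def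
    by (intro exI[of _ N] conjI exI[of _ "\<lambda>q. c * F q"] holomorphic_intros) auto
qed

text \<open>Two widths \<open>N\<close> and \<open>M\<close> are brought to the common width
  \<open>N * M\<close> by substituting powers of the local parameter, which map the unit disc into
  itself.\<close>

lemma holomorphic_at_cusp_add:
  assumes "holomorphic_at_cusp h1" "holomorphic_at_cusp h2"
  shows "holomorphic_at_cusp (\<lambda>\<tau>. h1 \<tau> + h2 \<tau>)"
proof -
  obtain N F where N: "N > 0" "F holomorphic_on ball 0 1" "\<forall>\<tau>\<in>upper_half_plane. h1 \<tau> = F (e_fun (\<tau> / of_nat N))"
    using assms(1) unfolding holomorphic_at_cusp_def by blast
  obtain M G where M: "M > 0" "G holomorphic_on ball 0 1" "\<forall>\<tau>\<in>upper_half_plane. h2 \<tau> = G (e_fun (\<tau> / of_nat M))"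
    using assms(2) unfolding holomorphic_at_cusp_def by blast
  have hol: "(\<lambda>q. F (q ^ n)) holomorphic_on ball 0 1" if "F holomorphic_on ball 0 1" "n > 0" for F :: "complex \<Rightarrow> complex" and n
  proof -
    have "(\<lambda>q. q ^ n) ` ball 0 1 \<subseteq> (ball 0 1 :: complex set)"
      using that(2) by (auto simp: norm_power power_less_one_iff)
    moreover have "(\<lambda>q. q ^ n) holomorphic_on (ball 0 1 :: complex set)"
      by (intro holomorphic_intros)
    ultimately show ?thesis
      using holomorphic_on_compose_gen[OF _ that(1)] by (force simp: o_def)
  qed
  have pw: "e_fun (\<tau> / of_nat (N * M)) ^ M = e_fun (\<tau> / of_nat N)" "e_fun (\<tau> / of_nat (N * M)) ^ N = e_fun (\<tau> / of_nat M)" for \<tau>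
    using N(1) M(1) by (simp_all add: e_fun_of_nat_mult[symmetric])
  show ?thesis unfolding holomorphic_at_cusp_def
    using N M pw
    by (intro exI[of _ "N * M"] conjI exI[of _ "\<lambda>q. F (q ^ M) + G (q ^ N)"] holomorphic_on_add hol) auto
qed

lemma holomorphic_at_cusp_sum:
  assumes "finite S" "\<And>x. x \<in> S \<Longrightarrow> holomorphic_at_cusp (h x)"
  shows "holomorphic_at_cusp (\<lambda>\<tau>. \<Sum>x\<in>S. h x \<tau>)"
  using assms
  by (induction S) (auto simp: holomorphic_at_cusp_zero intro!: holomorphic_at_cusp_add)

section \<open>The arrow down on modular forms\<close>

context isotropic_subgroup
begin

text \<open>Analytic conditions survive because \<open>down\<close> is a finite sum of components,
  and the transformation law follows from \<open>rho_D_down\<close>. The constant \<open>c\<close>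
  accommodates the coefficients of the final decomposition.\<close>

lemma down_modular_form:
  assumes f: "f \<in> modular_forms k A"
  shows "(\<lambda>\<tau> C. c * down (f \<tau>) C) \<in> modular_forms k D"
proof -
  obtain \<rho> where \<rho>: "is_weil_representation A \<rho>"
    "\<And>M \<phi> \<tau>. (M, \<phi>) \<in> carrier Mp2Z \<Longrightarrow> \<tau> \<in> upper_half_plane \<Longrightarrow>
      f (moebius_act M \<tau>) = (\<lambda>x. \<phi> \<tau> powi \<lfloor>2 * k\<rfloor> * \<rho> (M, \<phi>) (f \<tau>) x)"
    using f unfolding modular_forms_def by blast
  interpret isotropic_weil A H \<rho> by unfold_locales (rule \<rho>(1))
  have fA: "f \<tau> \<in> group_algebra A" if "\<tau> \<in> upper_half_plane" for \<tau>
    using f that unfolding modular_forms_def by blast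
  have hol: "(\<lambda>\<tau>. f \<tau> l) holomorphic_on upper_half_plane" "holomorphic_at_cusp (\<lambda>\<tau>. f \<tau> l)"
    if "l \<in> carrier A" for l
    using f that unfolding modular_forms_def by blast+
  have sub: "C \<subseteq> carrier A" if "C \<in> carrier D" for C
    using that coset_orth orth_mem by (fastforce simp: carrier_D)
  show ?thesis unfolding modular_forms_def
  proof (intro CollectI conjI ballI exI[of _ rho_D])
    fix \<tau> show "(\<lambda>C. c * down (f \<tau>) C) \<in> group_algebra D"
      by (rule group_algebra_scale[OF down_closed])
  next
    fix C assume C: "C \<in> carrier D"
    show "(\<lambda>\<tau>. c * down (f \<tau>) C) holomorphic_on upper_half_plane"
      unfolding down_def using C sub[OF C] by (auto intro!: holomorphic_intros hol(1))
    show "holomorphic_at_cusp (\<lambda>\<tau>. c * down (f \<tau>) C)"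
      unfolding down_def using C sub[OF C] finite_subset[OF sub[OF C] finite_carrier]
      by (auto intro!: holomorphic_at_cusp_scale holomorphic_at_cusp_sum hol(2))
  next
    show "is_weil_representation D rho_D" by (rule weil_D)
  next
    fix g assume g: "g \<in> carrier Mp2Z"
    obtain M \<phi> where M: "g = (M, \<phi>)" by fastforce
    have "(\<lambda>C. c * down (f (moebius_act M \<tau>)) C) =
        (\<lambda>C. \<phi> \<tau> powi \<lfloor>2 * k\<rfloor> * rho_D (M, \<phi>) (\<lambda>C. c * down (f \<tau>) C) C)"
      if \<tau>: "\<tau> \<in> upper_half_plane" for \<tau>
    proof -
      have "rho_D (M, \<phi>) (\<lambda>C. c * down (f \<tau>) C) = (\<lambda>C. c * down (\<rho> (M, \<phi>) (f \<tau>)) C)"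
        using rho_D_comb[of "(M, \<phi>)" "down (f \<tau>)" "down (f \<tau>)" c 0] rho_D_down[of "(M, \<phi>)" "f \<tau>"]
          g M down_closed fA[OF \<tau>] by simp
      moreover have "down (f (moebius_act M \<tau>)) = (\<lambda>C. \<phi> \<tau> powi \<lfloor>2 * k\<rfloor> * down (\<rho> (M, \<phi>) (f \<tau>)) C)"
        using \<rho>(2)[of M \<phi> \<tau>] g M \<tau> by (simp only: down_scale)
      ultimately show ?thesis by (simp only: mult.left_commute)
    qed
    then show "case g of (M, \<phi>) \<Rightarrow> \<forall>\<tau>\<in>upper_half_plane.
        (\<lambda>C. c * down (f (moebius_act M \<tau>)) C) =
        (\<lambda>C. \<phi> \<tau> powi \<lfloor>2 * k\<rfloor> * rho_D (M, \<phi>) (\<lambda>C. c * down (f \<tau>) C) C)"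
      by (simp add: M)
  qed
qed

end

section \<open>Fourier analysis along an isotropic element\<close>

text \<open>After division by the common gcd, some \<open>b' + n * a'\<close> has to be coprime to
  \<open>N'\<close>. A prime of \<open>N'\<close> dividing \<open>b'\<close> must divide neither
  \<open>a'\<close> nor \<open>n\<close>; a prime of \<open>N'\<close> not dividing
  \<open>b'\<close> must divide \<open>n\<close>.\<close>

lemma gcd_arithmetic_progression:
  fixes a b N :: nat
  assumes "N > 0"
  shows "\<exists>n. gcd (b + n * a) N = gcd (gcd a b) N"
proof -
  define g where "g = gcd (gcd a b) N"
  have g: "g > 0" using assms by (simp add: g_def)
  obtain a' where a': "a = g * a'" unfolding g_def by (metis dvd_def gcd_dvd1 dvd_trans)
  obtain b' where b': "b = g * b'" unfolding g_def by (metis dvd_def gcd_dvd1 gcd_dvd2 dvd_trans)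
  obtain N' where N': "N = g * N'" unfolding g_def by (metis dvd_def gcd_dvd2)
  have "g = g * gcd (gcd a' b') N'"
    by (subst (1) g_def) (simp add: a' b' N' gcd_mult_distrib_nat)
  then have c: "gcd (gcd a' b') N' = 1" using g by simp
  have N'0: "N' > 0" using assms N' by (cases N') auto
  \<comment> \<open>The product of exactly those primes of \<open>N'\<close> that do not divide
    \<open>b'\<close> meets both demands.\<close>
  define n where "n = \<Prod>{p. prime p \<and> p dvd N' \<and> \<not> p dvd b'}"
  have fin: "finite {p. prime p \<and> p dvd N' \<and> \<not> p dvd b'}"
    using N'0 by (intro finite_subset[OF _ finite_divisors_nat[of N']]) auto
  have "coprime (b' + n * a') N'"
  proof (rule ccontr)
    assume "\<not> coprime (b' + n * a') N'"
    then obtain p where "prime p" "p dvd gcd (b' + n * a') N'"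
      using prime_factor_nat coprime_iff_gcd_eq_1 by blast
    then have p: "prime p" "p dvd b' + n * a'" "p dvd N'" by simp_all
    show False
    proof (cases "p dvd b'")
      case True
      then have "p dvd n * a'" using p(2) by (simp add: dvd_add_right_iff)
      moreover have "\<not> p dvd a'"
        using c p(1,3) True by (metis gcd_greatest not_prime_unit)
      ultimately have "p dvd n" using p(1) by (simp add: prime_dvd_mult_iff)
      then obtain q where q: "prime q" "p dvd q" "\<not> q dvd b'"
        unfolding n_def using prime_dvd_prod_iff[OF fin p(1)] by auto
      then have "p = q" using p(1) primes_dvd_imp_eq by blast
      then show False using True q by simp
    next
      case False
      then have "p dvd n" unfolding n_def using p fin by (intro dvd_prodI[of _ _ "\<lambda>x. x", simplified]) auto
      then show False using False p(2) by (metis dvd_add_left_iff dvd_mult2)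
    qed
  qed
  then have "gcd (g * (b' + n * a')) (g * N') = g"
    by (simp add: gcd_mult_distrib_nat[symmetric])
  moreover have "g * (b' + n * a') = b + n * a"
    by (simp add: a' b' algebra_simps)
  ultimately have "gcd (b + n * a) N = g" by (simp only: N'[symmetric])
  then show ?thesis unfolding g_def by blast
qed

lemma sum_multiples:
  fixes f :: "nat \<Rightarrow> 'b::comm_monoid_add"
  assumes "q > 0"
  shows "(\<Sum>j\<in>{j. j < q * r \<and> q dvd j}. f j) = (\<Sum>i<r. f (q * i))"
  by (rule sum.reindex_bij_witness[of _ "\<lambda>i. q * i" "\<lambda>j. j div q"]) (use assms in auto)

text \<open>Moebius inversion done by recursion: in the equation for \<open>m\<close> the unknown
  \<open>c m\<close> has coefficient 1 and all others have smaller index.\<close>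

lemma divisor_sum_coefficients:
  "\<exists>c :: nat \<Rightarrow> complex. \<forall>m. 0 < m \<and> m \<le> n \<and> P m \<longrightarrow> (\<Sum>d | d dvd m \<and> P d. c d) = 1"
proof (induction n)
  case 0
  then show ?case by simp
next
  case (Suc n)
  then obtain c :: "nat \<Rightarrow> complex" where c: "\<And>m. 0 < m \<Longrightarrow> m \<le> n \<Longrightarrow> P m \<Longrightarrow> (\<Sum>d | d dvd m \<and> P d. c d) = 1"
    by blast
  \<comment> \<open>The new value solves the equation for \<open>Suc n\<close>; the earlier
    equations do not contain it.\<close>
  define c' where "c' = c(Suc n := 1 - (\<Sum>d\<in>{d. d dvd Suc n \<and> P d} - {Suc n}. c d))"
  have "(\<Sum>d | d dvd m \<and> P d. c' d) = 1" if m: "0 < m" "m \<le> Suc n" "P m" for m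
  proof (cases "m = Suc n")
    case False
    then have "(\<Sum>d | d dvd m \<and> P d. c' d) = (\<Sum>d | d dvd m \<and> P d. c d)"
      using m by (intro sum.cong) (auto simp: c'_def dest: dvd_imp_le)
    then show ?thesis using c m False by simp
  next
    case True
    have "(\<Sum>d | d dvd m \<and> P d. c' d) = c' m + (\<Sum>d\<in>{d. d dvd m \<and> P d} - {m}. c' d)"
      using m by (intro sum.remove) auto
    also have "(\<Sum>d\<in>{d. d dvd m \<and> P d} - {m}. c' d) = (\<Sum>d\<in>{d. d dvd m \<and> P d} - {m}. c d)"
      using True by (intro sum.cong) (auto simp: c'_def)
    finally show ?thesis using True by (simp add: c'_def)
  qed
  then show ?case by blast
qed

section \<open>Eigenspaces of translation by the isotropic element\<close>

locale isotropic_element = discriminant_form A for A :: "'a disc_form" (structure) +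
  fixes e
  assumes e_carrier: "e \<in> carrier A"
    and e_isotropic: "quad A e = 0"
begin

definition N :: nat where "N = ord e"
definition \<zeta> :: complex where "\<zeta> = e_fun (1 / of_nat N)"
text \<open>The entry \<open>a\<close> of the pairs \<open>(a,b)\<close>: the exponent itself, of
  which \<open>cont\<close> retains only the gcd with \<open>N\<close>.\<close>

definition level :: "'a \<Rightarrow> nat" where "level x = nat \<lfloor>of_nat N * unit_rep (bil A e x)\<rfloor>"

lemma N_pos: "N > 0"
  using ord_ge_1[OF finite_carrier e_carrier] by (simp add: N_def)

lemma e_pow_N: "e [^] N = \<one>"
  using e_carrier by (simp add: N_def)

lemma cont_eq: "cont A e x = gcd (level x) N"
  by (simp add: cont_def level_def N_def Let_def)

lemma zeta_nonzero [simp]: "\<zeta> \<noteq> 0"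
  by (simp add: \<zeta>_def)

lemma zeta_power_eq_1_iff: "\<zeta> ^ m = 1 \<longleftrightarrow> N dvd m"
  unfolding \<zeta>_def by (rule e_fun_power_eq_1_iff[OF N_pos])

lemma e_class_bil_e:
  assumes "x \<in> carrier A"
  shows "e_class (bil A e x) = \<zeta> ^ level x"
proof -
  have "int_scale (int N) (bil A e x) = 0"
    using bil_pow[OF e_carrier assms, of N] assms by (simp add: e_pow_N)
  then show ?thesis
    unfolding \<zeta>_def level_def by (rule e_class_root_of_unity[OF N_pos])
qed

lemma e_class_bil_e_pow:
  "x \<in> carrier A \<Longrightarrow> e_class (bil A (e [^] j) x) = (\<zeta> ^ level x) ^ j" for j :: nat
  by (simp add: bil_pow e_carrier e_class_int_scale e_class_bil_e)

lemma quad_e_pow: "quad A (e [^] j) = 0" for j :: nat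
  using quad_int_pow[OF e_carrier, of "int j"]
  by (simp add: e_isotropic int_scale_zero int_pow_int)

text \<open>Multiplication by \<open>e_class (quad A x)\<close> changes the eigenvalue under
  translation by \<open>e\<close> by the factor \<open>\<zeta> ^ level x\<close>: this is how
  \<open>T\<close> sends \<open>(a,b)\<close> to \<open>(a,b+a)\<close>.\<close>

lemma e_class_quad_shift:
  "x \<in> carrier A \<Longrightarrow> e_class (quad A (e [^] j \<otimes> x)) = (\<zeta> ^ level x) ^ j * e_class (quad A x)" for j :: nat
  by (simp add: quad_mult quad_e_pow e_class_add e_class_bil_e_pow)

text \<open>Up to a scalar the hypothesis says that \<open>S\<close> applied after the
  \<open>n\<close>-th power of \<open>T\<close> to \<open>v\<close> vanishes at all points of one
  content. Restricting that transform to the points with \<open>level y\<close> congruent to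
  \<open>b + n * level x\<close> modulo \<open>N\<close> gives zero, and Fourier inversion at
  \<open>x\<close> recovers a nonzero multiple of the component of \<open>v\<close> with index
  \<open>b\<close>.\<close>

lemma fourier_vanish:
  fixes v :: "'a \<Rightarrow> complex" and b n :: nat
  assumes x: "x \<in> carrier A"
    and hyp: "\<And>y. y \<in> carrier A \<Longrightarrow> cont A e y = gcd (b + n * level x) N \<Longrightarrow>
      (\<Sum>l\<in>carrier A. e_class (- bil A l y) * (e_class (quad A l) ^ n * v l)) = 0"
  shows "(\<Sum>j<N. inverse (\<zeta> ^ b) ^ j * v (e [^] j \<otimes> x)) = 0"
proof -
  define u where "u = (\<lambda>l. e_class (quad A l) ^ n * v l)"
  define w where "w = inverse (\<zeta> ^ (b + n * level x))"
  define F where "F = (\<lambda>y. \<Sum>l\<in>carrier A. e_class (- bil A l y) * u l)"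
  \<comment> \<open>The geometric sum selects the \<open>y\<close> with the prescribed level modulo
    \<open>N\<close>; for these the content is the one in the hypothesis, so \<open>F y\<close> is
    0.\<close>
  have zero: "F y * (\<Sum>j<N. (w * e_class (bil A e y)) ^ j) = 0" if y: "y \<in> carrier A" for y
  proof (cases "w * e_class (bil A e y) = 1")
    case True
    then have "\<zeta> ^ level y = \<zeta> ^ (b + n * level x)"
      by (simp add: w_def e_class_bil_e y field_simps)
    then have "cont A e y = gcd (b + n * level x) N"
      unfolding cont_eq \<zeta>_def by (rule gcd_eq_if_e_fun_power_eq[OF N_pos])
    then show ?thesis using hyp[OF y] by (simp add: F_def u_def)
  next
    case False
    have "(\<zeta> ^ k) ^ N = 1" for k
      by (simp only: power_mult[symmetric] zeta_power_eq_1_iff) simp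
    then have "(w * e_class (bil A e y)) ^ N = 1"
      by (simp add: w_def e_class_bil_e y power_mult_distrib power_inverse)
    then show ?thesis using False by (simp add: sum_powers_root_of_unity)
  qed
  have char: "e_class (bil A x y) * (e_class (- bil A l y) * e_class (bil A e y) ^ j)
      = e_class (bil A (e [^] j \<otimes> x \<otimes> inv l) y)"
    if "y \<in> carrier A" "l \<in> carrier A" for y l and j :: nat
  proof -
    have "bil A (e [^] j \<otimes> x \<otimes> inv l) y = bil A x y + (- bil A l y + bil A (e [^] j) y)"
      using that x e_carrier by (simp add: bil_mult_left bil_inv_left)
    then show ?thesis
      using that(1) by (simp only: e_class_add e_class_bil_e_pow e_class_bil_e)
  qed
  have "0 = (\<Sum>y\<in>carrier A. e_class (bil A x y) * (F y * (\<Sum>j<N. (w * e_class (bil A e y)) ^ j)))"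
    by (simp add: zero)
  also have "\<dots> = (\<Sum>y\<in>carrier A. \<Sum>l\<in>carrier A. \<Sum>j<N.
      w ^ j * (u l * e_class (bil A (e [^] j \<otimes> x \<otimes> inv l) y)))"
  proof (rule sum.cong[OF refl])
    fix y assume y: "y \<in> carrier A"
    have "e_class (bil A x y) * (F y * (\<Sum>j<N. (w * e_class (bil A e y)) ^ j)) =
      (\<Sum>l\<in>carrier A. \<Sum>j<N. e_class (bil A x y) * ((e_class (- bil A l y) * u l) * (w * e_class (bil A e y)) ^ j))"
      unfolding F_def sum_product by (simp only: sum_distrib_left)
    also have "\<dots> = (\<Sum>l\<in>carrier A. \<Sum>j<N. w ^ j * (u l * e_class (bil A (e [^] j \<otimes> x \<otimes> inv l) y)))"
      by (intro sum.cong refl) (simp only: char[OF y, symmetric] power_mult_distrib mult_ac)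
    finally show "e_class (bil A x y) * (F y * (\<Sum>j<N. (w * e_class (bil A e y)) ^ j)) =
      (\<Sum>l\<in>carrier A. \<Sum>j<N. w ^ j * (u l * e_class (bil A (e [^] j \<otimes> x \<otimes> inv l) y)))" .
  qed
  also have "\<dots> = (\<Sum>l\<in>carrier A. \<Sum>j<N. \<Sum>y\<in>carrier A. w ^ j * (u l * e_class (bil A (e [^] j \<otimes> x \<otimes> inv l) y)))"
    by (subst sum.swap) (intro sum.cong refl sum.swap)
  also have "\<dots> = (\<Sum>j<N. \<Sum>l\<in>carrier A. \<Sum>y\<in>carrier A. w ^ j * (u l * e_class (bil A (e [^] j \<otimes> x \<otimes> inv l) y)))"
    by (rule sum.swap)
  \<comment> \<open>By nondegeneracy the sum over \<open>y\<close> forces \<open>l\<close> to be the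
    translate of \<open>x\<close> by the \<open>j\<close>-th power of \<open>e\<close>.\<close>
  also have "\<dots> = (\<Sum>j<N. of_nat (card (carrier A)) * (w ^ j * u (e [^] j \<otimes> x)))"
  proof (rule sum.cong[OF refl])
    fix j :: nat
    have ex: "e [^] j \<otimes> x \<in> carrier A" using x e_carrier by simp
    have "(\<Sum>l\<in>carrier A. \<Sum>y\<in>carrier A. w ^ j * (u l * e_class (bil A (e [^] j \<otimes> x \<otimes> inv l) y)))
      = (\<Sum>l\<in>carrier A. if l = e [^] j \<otimes> x then w ^ j * (u l * of_nat (card (carrier A))) else 0)"
    proof (rule sum.cong[OF refl])
      fix l assume l: "l \<in> carrier A"
      have "e [^] j \<otimes> x \<otimes> inv l = \<one> \<longleftrightarrow> l = e [^] j \<otimes> x"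
        using ex l by (metis inv_closed inv_equality inv_inv r_inv)
      then show "(\<Sum>y\<in>carrier A. w ^ j * (u l * e_class (bil A (e [^] j \<otimes> x \<otimes> inv l) y)))
        = (if l = e [^] j \<otimes> x then w ^ j * (u l * of_nat (card (carrier A))) else 0)"
        using ex l by (simp only: sum_distrib_left[symmetric] sum_character_carrier[OF m_closed[OF ex inv_closed[OF l]]]) simp
    qed
    then show "(\<Sum>l\<in>carrier A. \<Sum>y\<in>carrier A. w ^ j * (u l * e_class (bil A (e [^] j \<otimes> x \<otimes> inv l) y)))
      = of_nat (card (carrier A)) * (w ^ j * u (e [^] j \<otimes> x))"
      using ex finite_carrier by (simp add: mult_ac)
  qed
  also have "\<dots> = (\<Sum>j<N. of_nat (card (carrier A)) * e_class (quad A x) ^ n *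
      (inverse (\<zeta> ^ b) ^ j * v (e [^] j \<otimes> x)))"
  proof (rule sum.cong[OF refl])
    fix j :: nat
    have "u (e [^] j \<otimes> x) = ((\<zeta> ^ level x) ^ j) ^ n * e_class (quad A x) ^ n * v (e [^] j \<otimes> x)"
      by (simp add: u_def e_class_quad_shift x power_mult_distrib)
    \<comment> \<open>The powers of \<open>\<zeta>\<close> from the quadratic form cancel the part
      \<open>n * level x\<close> of the exponent in \<open>w\<close>, leaving only
      \<open>b\<close>.\<close>
    moreover have "w ^ j * ((\<zeta> ^ level x) ^ j) ^ n = inverse (\<zeta> ^ b) ^ j"
    proof -
      have "((\<zeta> ^ level x) ^ j) ^ n = (\<zeta> ^ (n * level x)) ^ j"
        by (simp only: power_mult[symmetric] mult_ac)
      then show ?thesis by (simp add: w_def power_add power_inverse power_mult_distrib field_simps)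
    qed
    ultimately show "of_nat (card (carrier A)) * (w ^ j * u (e [^] j \<otimes> x)) =
      of_nat (card (carrier A)) * e_class (quad A x) ^ n * (inverse (\<zeta> ^ b) ^ j * v (e [^] j \<otimes> x))"
      by (simp add: mult_ac)
  qed
  also have "\<dots> = of_nat (card (carrier A)) * e_class (quad A x) ^ n *
      (\<Sum>j<N. inverse (\<zeta> ^ b) ^ j * v (e [^] j \<otimes> x))"
    by (rule sum_distrib_left[symmetric])
  finally show ?thesis
    using finite_carrier one_closed by (auto simp: card_eq_0_iff)
qed

text \<open>The value at \<open>x\<close> of the projection of \<open>v\<close> to the eigenspace of
  translation by \<open>e\<close> with eigenvalue \<open>\<zeta> ^ b\<close>.\<close>

definition fourier :: "('a \<Rightarrow> complex) \<Rightarrow> 'a \<Rightarrow> nat \<Rightarrow> complex" where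
  "fourier v x b = (\<Sum>j<N. inverse (\<zeta> ^ b) ^ j * v (e [^] j \<otimes> x)) / of_nat N"

text \<open>Averaging over \<open>I_sub A e d\<close> is the projection to the indices
  \<open>b\<close> divisible by \<open>d\<close>: the sum of the characters with these indices
  vanishes at \<open>j\<close> unless \<open>N div d\<close> divides \<open>j\<close>.\<close>

lemma sum_fourier_multiples:
  assumes d: "d dvd N"
  shows "(\<Sum>b\<in>{b. b < N \<and> d dvd b}. fourier v x b) = (\<Sum>i<d. v (e [^] (N div d * i) \<otimes> x)) / of_nat d"
proof -
  obtain q where q: "N = d * q" using d by auto
  have pos: "d > 0" "q > 0" using N_pos q by (auto intro: Nat.gr0I)
  have inner: "(\<Sum>c<q. (inverse (\<zeta> ^ (d * j))) ^ c) = (if q dvd j then of_nat q else 0)" for j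
  proof -
    have 1: "inverse (\<zeta> ^ (d * j)) = 1 \<longleftrightarrow> q dvd j"
      using zeta_power_eq_1_iff[of "d * j"] pos by (simp add: q inverse_eq_1_iff)
    have "(\<zeta> ^ (d * j)) ^ q = 1"
      by (simp only: power_mult[symmetric] zeta_power_eq_1_iff q) simp
    then have "inverse (\<zeta> ^ (d * j)) ^ q = 1" by (simp add: power_inverse)
    then show ?thesis using 1 by (simp add: sum_powers_root_of_unity)
  qed
  have "(\<Sum>b\<in>{b. b < N \<and> d dvd b}. fourier v x b) = (\<Sum>c<q. fourier v x (d * c))"
    unfolding q by (rule sum_multiples[OF pos(1)])
  also have "\<dots> = (\<Sum>c<q. \<Sum>j<N. inverse (\<zeta> ^ (d * c)) ^ j * v (e [^] j \<otimes> x)) / of_nat N"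
    by (simp add: fourier_def sum_divide_distrib)
  also have "(\<Sum>c<q. \<Sum>j<N. inverse (\<zeta> ^ (d * c)) ^ j * v (e [^] j \<otimes> x)) =
      (\<Sum>j<N. (\<Sum>c<q. (inverse (\<zeta> ^ (d * j))) ^ c) * v (e [^] j \<otimes> x))"
  proof -
    have "inverse (\<zeta> ^ (d * c)) ^ j = (inverse (\<zeta> ^ (d * j))) ^ c" for c j
      by (simp only: power_inverse[symmetric] power_mult[symmetric] mult_ac)
    then show ?thesis unfolding sum_distrib_right by (subst sum.swap) simp
  qed
  also have "\<dots> = (\<Sum>j<q * d. if q dvd j then of_nat q * v (e [^] j \<otimes> x) else 0)"
  proof (rule sum.cong)
    show "{..<N} = {..<q * d}" by (simp add: q mult.commute)
  qed (simp add: inner)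
  also have "\<dots> = (\<Sum>j\<in>{j. j < q * d \<and> q dvd j}. of_nat q * v (e [^] j \<otimes> x))"
    by (rule sum.mono_neutral_cong_right) auto
  also have "\<dots> = (\<Sum>i<d. of_nat q * v (e [^] (q * i) \<otimes> x))"
    by (rule sum_multiples[OF pos(2)])
  also have "\<dots> = of_nat q * (\<Sum>i<d. v (e [^] (q * i) \<otimes> x))"
    by (rule sum_distrib_left[symmetric])
  finally show ?thesis using pos by (simp add: q)
qed

lemma sum_fourier:
  assumes "x \<in> carrier A"
  shows "(\<Sum>b<N. fourier v x b) = v x"
proof -
  have "{b. b < N \<and> 1 dvd b} = {..<N}" by auto
  then show ?thesis using sum_fourier_multiples[of 1 v x] assms e_carrier by simp
qed

text \<open>The vanishing is assumed for every \<open>n\<close>, so \<open>n\<close> may be chosen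
  to make the content tested in \<open>fourier_vanish\<close> equal to the gcd of
  \<open>level x\<close>, \<open>b\<close> and \<open>N\<close>.\<close>

lemma fourier_support:
  assumes x: "x \<in> carrier A"
    and supp: "\<And>n y. y \<in> carrier A \<Longrightarrow> \<not> P (cont A e y) \<Longrightarrow>
      (\<Sum>l\<in>carrier A. e_class (- bil A l y) * (e_class (quad A l) ^ n * v l)) = 0"
    and "\<not> P (gcd (gcd (level x) b) N)"
  shows "fourier v x b = 0"
proof -
  obtain n where "gcd (b + n * level x) N = gcd (gcd (level x) b) N"
    using gcd_arithmetic_progression[OF N_pos] by blast
  then have "(\<Sum>j<N. inverse (\<zeta> ^ b) ^ j * v (e [^] j \<otimes> x)) = 0"
    using assms by (intro fourier_vanish[OF x, of b n]) auto
  then show ?thesis by (simp add: fourier_def)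
qed

text \<open>Exponents of the generator can be reduced modulo \<open>d\<close>, and those below
  \<open>d\<close> give exponents of \<open>e\<close> below its order, so they are distinct. Sums
  over the subgroup thus become sums over \<open>i < d\<close>.\<close>

lemma I_sub_eq:
  assumes d: "d dvd N"
  shows "I_sub A e d = (\<lambda>i. e [^] (N div d * i)) ` {..<d}"
    and "inj_on (\<lambda>i. e [^] (N div d * i)) {..<d}"
proof -
  obtain q where q: "N = d * q" using d by auto
  have pos: "d > 0" "q > 0" using N_pos q by (auto intro: Nat.gr0I)
  have qd: "N div d = q" using pos q by simp
  have eq: "e [^] (q * i) \<in> carrier A" for i using e_carrier by simp
  have "I_sub A e d = {(e [^] q) [^] k | k. k \<in> (UNIV :: nat set)}"
    unfolding I_sub_def N_def[symmetric] qd
    by (rule generate_pow_on_finite_carrier[OF finite_carrier]) (simp add: e_carrier)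
  also have "\<dots> = (\<lambda>i. e [^] (q * i)) ` {..<d}"
  proof -
    have "(e [^] q) [^] k = e [^] (q * (k mod d))" for k :: nat
    proof -
      have "q * k = q * (k mod d) + N * (k div d)"
        unfolding q by (metis add.commute distrib_left mod_mult_div_eq mult.commute mult.left_commute)
      then have "e [^] (q * k) = e [^] (q * (k mod d)) \<otimes> (e [^] N) [^] (k div d)"
        by (simp add: nat_pow_mult nat_pow_pow e_carrier)
      then show ?thesis by (simp add: e_pow_N nat_pow_pow e_carrier)
    qed
    moreover have "k mod d \<in> {..<d}" for k using pos by simp
    ultimately show ?thesis by (fastforce simp: nat_pow_pow e_carrier)
  qed
  finally show "I_sub A e d = (\<lambda>i. e [^] (N div d * i)) ` {..<d}" by (simp add: qd)
  have "inj_on (\<lambda>i. e [^] i) {0..ord e - 1}"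
    by (rule ord_inj[OF e_carrier])
  moreover have "q * i \<in> {0..ord e - 1}" if "i < d" for i
  proof -
    have "q * i < N" using that pos by (simp add: q)
    then show ?thesis by (simp add: N_def)
  qed
  ultimately show "inj_on (\<lambda>i. e [^] (N div d * i)) {..<d}"
    unfolding qd inj_on_def using pos by (metis lessThan_iff mult_left_cancel less_not_refl2)
qed

lemma isotropic_I_sub:
  assumes "d dvd N"
  shows "isotropic_subgroup A (I_sub A e d)"
proof (intro isotropic_subgroup.intro isotropic_subgroup_axioms.intro)
  show "discriminant_form A" by (rule discriminant_form_axioms)
  show "subgroup (I_sub A e d) A"
    unfolding I_sub_def by (rule generate_is_subgroup) (simp add: e_carrier)
  show "quad A h = 0" if "h \<in> I_sub A e d" for h
    using that I_sub_eq(1)[OF assms] quad_e_pow by auto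
qed

text \<open>A statement about a single vector: \<open>supp\<close> encodes the vanishing of all
  transforms of \<open>v\<close> under \<open>S\<close> after powers of \<open>T\<close>. After
  expansion into Fourier components, the coefficient of the component \<open>b\<close> is the sum of
  \<open>c d\<close> over the divisors of the gcd of \<open>level x\<close>, \<open>b\<close> and
  \<open>N\<close> that satisfy \<open>P\<close>.\<close>

lemma decomposition:
  fixes v :: "'a \<Rightarrow> complex" and c :: "nat \<Rightarrow> complex"
  assumes x: "x \<in> carrier A"
    and supp: "\<And>n y. y \<in> carrier A \<Longrightarrow> \<not> P (cont A e y) \<Longrightarrow>
      (\<Sum>l\<in>carrier A. e_class (- bil A l y) * (e_class (quad A l) ^ n * v l)) = 0"
    and c: "\<And>m. 0 < m \<Longrightarrow> m \<le> N \<Longrightarrow> P m \<Longrightarrow> (\<Sum>d | d dvd m \<and> P d. c d) = 1"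
  shows "v x = (\<Sum>d | d dvd N \<and> P d. c d / of_nat d *
      (if x \<in> orth A (I_sub A e d) then \<Sum>h\<in>I_sub A e d. v (h \<otimes> x) else 0))"
proof -
  have fin: "finite {d. d dvd N \<and> P d}" using N_pos by simp
  have "(\<Sum>d | d dvd N \<and> P d. c d / of_nat d *
      (if x \<in> orth A (I_sub A e d) then \<Sum>h\<in>I_sub A e d. v (h \<otimes> x) else 0)) =
    (\<Sum>d | d dvd N \<and> P d. \<Sum>b<N. if d dvd level x \<and> d dvd b then c d * fourier v x b else 0)"
  proof (rule sum.cong[OF refl])
    fix d assume "d \<in> {d. d dvd N \<and> P d}"
    then have d: "d dvd N" by simp
    have dx: "x \<in> orth A (I_sub A e d) \<longleftrightarrow> d dvd level x"
      using orth_I_sub[OF e_carrier, of d] d x by (simp add: cont_eq N_def)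
    have "(\<Sum>h\<in>I_sub A e d. v (h \<otimes> x)) / of_nat d = (\<Sum>b\<in>{b. b < N \<and> d dvd b}. fourier v x b)"
      unfolding sum_fourier_multiples[OF d] I_sub_eq(1)[OF d] sum.reindex[OF I_sub_eq(2)[OF d]] by simp
    also have "\<dots> = (\<Sum>b<N. if d dvd b then fourier v x b else 0)"
      by (rule sum.mono_neutral_cong_left) auto
    finally have calc: "c d / of_nat d * (\<Sum>h\<in>I_sub A e d. v (h \<otimes> x)) = c d * (\<Sum>b<N. if d dvd b then fourier v x b else 0)"
      by (metis times_divide_eq_left times_divide_eq_right)
    then show "c d / of_nat d * (if x \<in> orth A (I_sub A e d) then \<Sum>h\<in>I_sub A e d. v (h \<otimes> x) else 0) =
        (\<Sum>b<N. if d dvd level x \<and> d dvd b then c d * fourier v x b else 0)"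
    proof (cases "d dvd level x")
      case True
      have "(\<Sum>b<N. if d dvd level x \<and> d dvd b then c d * fourier v x b else 0) =
          c d * (\<Sum>b<N. if d dvd b then fourier v x b else 0)"
        unfolding sum_distrib_left using True by (intro sum.cong) auto
      then show ?thesis using True calc dx by (simp only: if_True)
    qed (simp add: dx)
  qed
  also have "\<dots> = (\<Sum>b<N. \<Sum>d | d dvd N \<and> P d. if d dvd level x \<and> d dvd b then c d * fourier v x b else 0)"
    by (rule sum.swap)
  also have "\<dots> = (\<Sum>b<N. fourier v x b)"
  proof (rule sum.cong[OF refl])
    fix b
    define m where "m = gcd (gcd (level x) b) N"
    have "(\<Sum>d | d dvd N \<and> P d. if d dvd level x \<and> d dvd b then c d * fourier v x b else 0)
      = (\<Sum>d | d dvd m \<and> P d. c d * fourier v x b)"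
      using fin by (intro sum.mono_neutral_cong_right) (auto simp: m_def)
    also have "\<dots> = (\<Sum>d | d dvd m \<and> P d. c d) * fourier v x b"
      by (rule sum_distrib_right[symmetric])
    also have "\<dots> = fourier v x b"
    \<comment> \<open>Either the coefficients add up to 1, or the component itself is zero.\<close>
    proof (cases "P m")
      case True
      have "0 < m" "m \<le> N" using N_pos by (auto simp: m_def intro: dvd_imp_le)
      then show ?thesis using c[OF _ _ True] by simp
    next
      case False
      then have "fourier v x b = 0"
        unfolding m_def by (intro fourier_support[OF x, of P]) (auto simp: supp)
      then show ?thesis by simp
    qed
    finally show "(\<Sum>d | d dvd N \<and> P d. if d dvd level x \<and> d dvd b then c d * fourier v x b else 0) = fourier v x b" .
  qed
  also have "\<dots> = v x" by (rule sum_fourier[OF x])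
  finally show ?thesis ..
qed

end

section \<open>Support of modular forms and the final decomposition\<close>

lemma (in weil_representation) rho_T_pow:
  assumes "v \<in> group_algebra A"
  shows "\<rho> (Mp2_T_pow (int n)) v = (\<lambda>x. e_class (quad A x) ^ n * v x)"
proof (induction n)
  case 0
  then show ?case using assms by (simp add: Mp2_T_pow_0 rho_one)
next
  case (Suc n)
  have "Mp2_T_pow (int (Suc n)) = Mp2_T \<otimes>\<^bsub>Mp2Z\<^esub> Mp2_T_pow (int n)"
    by (simp add: Mp2_T_eq Mp2_T_pow_add)
  then have "\<rho> (Mp2_T_pow (int (Suc n))) v = \<rho> Mp2_T (\<rho> (Mp2_T_pow (int n)) v)"
    by (simp only: rho_mult[OF Mp2_T_closed Mp2_T_pow_closed assms])
  also have "\<dots> = (\<lambda>x. e_class (quad A x) * \<rho> (Mp2_T_pow (int n)) v x)"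
    by (rule rho_T[OF rho_closed[OF Mp2_T_pow_closed assms]])
  finally show ?case by (simp add: Suc.IH mult_ac)
qed

text \<open>A component vanishing on the whole half-plane vanishes in particular at the image of
  \<open>\<tau>\<close> under \<open>S\<close> times a power of \<open>T\<close>. The transformation
  law moves this to \<open>\<tau>\<close>, and the factor of automorphy and \<open>S_factor\<close>
  can be cancelled as they are nonzero.\<close>

lemma (in discriminant_form) modular_form_support:
  assumes f: "f \<in> modular_forms k A"
    and supp: "\<And>\<tau>. \<tau> \<in> upper_half_plane \<Longrightarrow> f \<tau> y = 0"
    and y: "y \<in> carrier A" and \<tau>: "\<tau> \<in> upper_half_plane"
  shows "(\<Sum>l\<in>carrier A. e_class (- bil A l y) * (e_class (quad A l) ^ n * f \<tau> l)) = 0"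
proof -
  obtain \<rho> where \<rho>: "is_weil_representation A \<rho>"
    "\<And>M \<phi> \<tau>. (M, \<phi>) \<in> carrier Mp2Z \<Longrightarrow> \<tau> \<in> upper_half_plane \<Longrightarrow>
      f (moebius_act M \<tau>) = (\<lambda>x. \<phi> \<tau> powi \<lfloor>2 * k\<rfloor> * \<rho> (M, \<phi>) (f \<tau>) x)"
    using f unfolding modular_forms_def by blast
  interpret weil_representation A \<rho> by unfold_locales (rule \<rho>(1))
  have fA: "f \<tau> \<in> group_algebra A"
    using f \<tau> unfolding modular_forms_def by blast
  obtain M \<phi> where M: "Mp2_S \<otimes>\<^bsub>Mp2Z\<^esub> Mp2_T_pow (int n) = (M, \<phi>)" by fastforce
  then have g: "(M, \<phi>) \<in> carrier Mp2Z"
    using Mp2Z_mult_closed[OF Mp2_S_closed Mp2_T_pow_closed] by metis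
  then have "moebius_act M \<tau> \<in> upper_half_plane"
    using moebius_act_closed[OF _ \<tau>] by (simp add: Mp2Z_mem)
  then have "\<rho> (M, \<phi>) (f \<tau>) y = 0"
    using \<rho>(2)[OF g \<tau>] supp Mp2Z_factor_nonzero[OF g \<tau>] by (metis mult_eq_0_iff power_int_eq_0_iff)
  moreover have "\<rho> (M, \<phi>) (f \<tau>) = \<rho> Mp2_S (\<lambda>x. e_class (quad A x) ^ n * f \<tau> x)"
    unfolding M[symmetric] rho_mult[OF Mp2_S_closed Mp2_T_pow_closed fA] rho_T_pow[OF fA] ..
  moreover have "(\<lambda>x. e_class (quad A x) ^ n * f \<tau> x) \<in> group_algebra A"
    using fA by (simp add: group_algebra_def)
  ultimately show ?thesis
    using y S_factor_nonzero by (simp add: rho_S)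
qed

theorem theorem3p10:
  fixes A :: "'a disc_form" and k :: rat and e :: 'a and N t :: nat
    and f :: "complex \<Rightarrow> 'a \<Rightarrow> complex"
  assumes "discriminant_form A"
    and "2 * k \<in> \<int>"
    and "e \<in> carrier A" and "quad A e = 0" and "group.ord A e = N"
    and "f \<in> modular_forms k A"
    and "\<forall>\<tau>\<in>upper_half_plane. \<forall>l\<in>carrier A. \<not> big_omega (cont A e l) \<ge> t \<longrightarrow> f \<tau> l = 0"
  shows "\<exists>fd :: nat \<Rightarrow> complex \<Rightarrow> 'a set \<Rightarrow> complex.
    (\<forall>d. d dvd N \<and> big_omega d \<ge> t \<longrightarrow> fd d \<in> modular_forms k (subquotient A (I_sub A e d))) \<and>
    (\<forall>\<tau>\<in>upper_half_plane. f \<tau> =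
       (\<lambda>x. \<Sum>d | d dvd N \<and> big_omega d \<ge> t. up_arrow A (I_sub A e d) (fd d) \<tau> x))"
proof -
  interpret discriminant_form A by fact
  interpret E: isotropic_element A e by unfold_locales fact+
  have N: "E.N = N" using assms(5) by (simp add: E.N_def)
  let ?P = "\<lambda>d. big_omega d \<ge> t"
  obtain c :: "nat \<Rightarrow> complex" where c:
    "\<And>m. 0 < m \<Longrightarrow> m \<le> N \<Longrightarrow> ?P m \<Longrightarrow> (\<Sum>d | d dvd m \<and> ?P d. c d) = 1"
    using divisor_sum_coefficients[of N ?P] by blast
  \<comment> \<open>With the factor \<open>c d / of_nat d\<close>, the arrow up of
    \<open>fd d\<close> is \<open>c d\<close> times \<open>P\<^sub>d\<close> applied to
    \<open>f\<close>.\<close>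
  define fd where "fd = (\<lambda>d \<tau> C. c d / of_nat d * isotropic_subgroup.down A (I_sub A e d) (f \<tau>) C)"
  have up: "up_arrow A (I_sub A e d) (fd d) \<tau> x = c d / of_nat d *
      (if x \<in> orth A (I_sub A e d) then \<Sum>h\<in>I_sub A e d. f \<tau> (h \<otimes>\<^bsub>A\<^esub> x) else 0)"
    if "d dvd N" for d \<tau> x
  proof -
    interpret I: isotropic_subgroup A "I_sub A e d" using E.isotropic_I_sub that N by simp
    show ?thesis unfolding fd_def I.up_arrow_eq I.up_scale I.up_down ..
  qed
  have "fd d \<in> modular_forms k (subquotient A (I_sub A e d))" if "d dvd N" for d
  proof -
    interpret I: isotropic_subgroup A "I_sub A e d" using E.isotropic_I_sub that N by simp
    show ?thesis unfolding fd_def by (rule I.down_modular_form) fact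
  qed
  moreover have "f \<tau> x = (\<Sum>d | d dvd N \<and> ?P d. up_arrow A (I_sub A e d) (fd d) \<tau> x)"
    if \<tau>: "\<tau> \<in> upper_half_plane" for \<tau> x
  proof (cases "x \<in> carrier A")
    case True
    have "f \<tau> x = (\<Sum>d | d dvd N \<and> ?P d. c d / of_nat d *
        (if x \<in> orth A (I_sub A e d) then \<Sum>h\<in>I_sub A e d. f \<tau> (h \<otimes>\<^bsub>A\<^esub> x) else 0))"
      unfolding N[symmetric]
      using modular_form_support[OF assms(6)] assms(7) \<tau> c
      by (intro E.decomposition[OF True]) (auto simp: N)
    then show ?thesis by (simp add: up)
  next
    case False
    \<comment> \<open>Equality of functions is also required off the carrier, where both sides are
      0.\<close>
    then have "f \<tau> x = 0" using assms(6) \<tau> by (auto simp: modular_forms_def group_algebra_def)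
    moreover have "x \<notin> orth A (I_sub A e d)" for d using False by (simp add: orth_def)
    ultimately show ?thesis by (simp add: up)
  qed
  ultimately show ?thesis by blast
qed

end
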